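(* The expressivity of the KR Logic $\mathcal{L}(\mathcal{F})$, where $\mathcal{F}$ is the flip-flop operator, is the class of star-free regular languages.
   Context: Write $\mathbb{B}=\{0,1\}$. Static formulas are built from propositional variables and $\top,\bot$ using $\neg,\land,\lor$. An operator automaton is $\mathcal{A}=\langle \mathbb{B}^m,[1,n],\delta,q_{\mathrm{init}}\rangle$ with $\delta:[1,n]\times\mathbb{B}^m\to[1,n]$, $q_{\mathrm{init}}\in[1,n]$. Rules: static $p \;{:}{-}\; \alpha$; delay $p \;{:}{-}\; \ominus q$; dynamic $p_1,\dots,p_n \;{:}{-}\; \mathcal{A}(a_1,\dots,a_m)$. A program is a finite set of rules that is nonrecursive (the graph with an edge $a\to b$ whenever $a$ occurs in the body and $b$ in the head of a rule is acyclic) and definitorial (each variable is in at most one head). Non-defined variables are input variables; an interpretation is a finite non-empty sequence $I=I_1,\dots,I_\ell$ of subsets of input variables. Satisfaction $(P,I,t)\models\cdot$: $\top$ holds, $\bot$ not; input $a$ holds iff $a\in I_t$; Boolean connectives as usual; $p$ defined by $p\;{:}{-}\;\alpha$ iff $(P,I,t)\models\alpha$; $p$ defined by $p\;{:}{-}\;\ominus q$ iff $(P,I,t-1)\models q$; for $p_i$ defined by a dynamic rule, $(P,I,0)\models p_i$ iff $q_{\mathrm{init}}=i$, and for $t>0$, $(P,I,t)\models p_i$ iff there are $j$ and $\sigma\in\mathbb{B}^m$ (an assignment to $a_1,\dots,a_m$, identified with the conjunction of literals it makes true) with $\delta(j,\sigma)=i$, $(P,I,t-1)\models p_j$, $(P,I,t)\models\sigma$.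 For a set $\mathbf{A}$ of operator automata, $\mathcal{L}(\mathbf{A})$ is the set of programs consisting of static rules, delay rules and dynamic rules with operators from $\mathbf{A}$. A program with ordered input variables $x_1,\dots,x_m$ and a designated variable $a$ recognises the language of strings $\sigma_1\dots\sigma_\ell$ over $\mathbb{B}^m$ (letters read as assignments to the input variables) with $(P,I,\ell)\models a$; the expressivity of a logic is the set of languages its programs recognise. The flip-flop operator is $\mathcal{F}=\langle\mathbb{B}^2,\{1,2\},\delta,1\rangle$ with $\delta(q,00)=q$, $\delta(q,10)=\delta(q,11)=2$, $\delta(q,01)=1$. Star-free regular languages are those definable by regular expressions built from letters and the empty set using union, concatenation and complementation, without Kleene star.
   Formalization: The class is taken to be the star-free languages over 𝔹^m that do not contain the empty string: interpretations are non-empty, so no program recognises a language containing it, although some star-free languages (e.g. the set of all strings) do. *)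

theory Defs
  imports Main
begin

section \<open>Syntax\<close>

text \<open>The supply of propositional variables is countably infinite.\<close>

type_synonym var = nat

datatype sform = Top | Bot | Var var | Neg sform | And sform sform | Or sform sform

primrec vars_sform :: "sform \<Rightarrow> var set" where
  "vars_sform Top = {}"
| "vars_sform Bot = {}"
| "vars_sform (Var p) = {p}"
| "vars_sform (Neg \<phi>) = vars_sform \<phi>"
| "vars_sform (And \<phi> \<psi>) = vars_sform \<phi> \<union> vars_sform \<psi>"
| "vars_sform (Or \<phi> \<psi>) = vars_sform \<phi> \<union> vars_sform \<psi>"

text \<open>
  The elements of \<open>\<bool>\<^sup>m\<close> are the Boolean lists of length \<open>m\<close>.
\<close>

definition bools :: "nat \<Rightarrow> bool list set" where
  "bools m = {\<sigma>. length \<sigma> = m}"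

text \<open>
  An operator automaton has inputs \<open>bools (arity A)\<close> and states \<open>{1..states A}\<close>; the values of
  \<open>delta A\<close> outside this domain are irrelevant.
\<close>

record op_automaton =
  arity :: nat
  states :: nat
  delta :: "nat \<Rightarrow> bool list \<Rightarrow> nat"
  init :: nat

definition wf_automaton :: "op_automaton \<Rightarrow> bool" where
  "wf_automaton A \<longleftrightarrow> init A \<in> {1..states A} \<and>
     (\<forall>q\<in>{1..states A}. \<forall>\<sigma>\<in>bools (arity A). delta A q \<sigma> \<in> {1..states A})"

datatype rule =
    Static var sform
  | Delay var var
  | Dynamic "var list" op_automaton "var list"

fun rule_head :: "rule \<Rightarrow> var set" where
  "rule_head (Static p \<alpha>) = {p}"
| "rule_head (Delay p q) = {p}"
| "rule_head (Dynamic ps A as) = set ps"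

fun rule_body :: "rule \<Rightarrow> var set" where
  "rule_body (Static p \<alpha>) = vars_sform \<alpha>"
| "rule_body (Delay p q) = {q}"
| "rule_body (Dynamic ps A as) = set as"

text \<open>
  The head variables of a dynamic rule are required to be distinct: each of them stands for one
  state of the automaton, and a repeated one would be defined twice.
\<close>

fun wf_rule :: "rule \<Rightarrow> bool" where
  "wf_rule (Static p \<alpha>) \<longleftrightarrow> True"
| "wf_rule (Delay p q) \<longleftrightarrow> True"
| "wf_rule (Dynamic ps A as) \<longleftrightarrow>
     wf_automaton A \<and> length ps = states A \<and> distinct ps \<and> length as = arity A"

definition dep_graph :: "rule set \<Rightarrow> (var \<times> var) set" where
  "dep_graph P = {(a, b). \<exists>r\<in>P. a \<in> rule_body r \<and> b \<in> rule_head r}"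

definition nonrecursive :: "rule set \<Rightarrow> bool" where
  "nonrecursive P \<longleftrightarrow> acyclic (dep_graph P)"

definition definitorial :: "rule set \<Rightarrow> bool" where
  "definitorial P \<longleftrightarrow> (\<forall>r\<in>P. \<forall>r'\<in>P. rule_head r \<inter> rule_head r' \<noteq> {} \<longrightarrow> r = r')"

definition program :: "rule set \<Rightarrow> bool" where
  "program P \<longleftrightarrow> finite P \<and> (\<forall>r\<in>P. wf_rule r) \<and> nonrecursive P \<and> definitorial P"

definition vars :: "rule set \<Rightarrow> var set" where
  "vars P = (\<Union>r\<in>P. rule_head r \<union> rule_body r)"

definition defined_vars :: "rule set \<Rightarrow> var set" where
  "defined_vars P = (\<Union>r\<in>P. rule_head r)"

definition input_vars :: "rule set \<Rightarrow> var set" where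
  "input_vars P = vars P - defined_vars P"


section \<open>Semantics\<close>

text \<open>The following measure serves only to show that satisfaction is well defined.\<close>

definition var_rank :: "rule set \<Rightarrow> var \<Rightarrow> nat" where
  "var_rank P v = card {u. (u, v) \<in> (dep_graph P)\<^sup>+}"

definition sform_rank :: "rule set \<Rightarrow> sform \<Rightarrow> nat" where
  "sform_rank P \<phi> = Max (insert 0 ((\<lambda>v. Suc (var_rank P v)) ` vars_sform \<phi>))"

lemma finite_vars_sform [simp]: "finite (vars_sform \<phi>)"
  by (induction \<phi>) auto

lemma finite_dep_graph:
  assumes "program P"
  shows "finite (dep_graph P)"
proof -
  have "finite (rule_body r \<times> rule_head r)" for r
    by (cases r) auto
  then have "finite (\<Union>r\<in>P. rule_body r \<times> rule_head r)"
    using assms by (auto simp: program_def)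
  moreover have "dep_graph P = (\<Union>r\<in>P. rule_body r \<times> rule_head r)"
    by (auto simp: dep_graph_def)
  ultimately show ?thesis
    by simp
qed

lemma var_rank_less:
  assumes P: "program P" and e: "(u, v) \<in> dep_graph P"
  shows "var_rank P u < var_rank P v"
proof -
  let ?E = "dep_graph P"
  have ac: "acyclic ?E"
    using P by (simp add: program_def nonrecursive_def)
  have "finite (?E\<^sup>+)"
    using finite_dep_graph[OF P] by simp
  then have "finite (fst ` ?E\<^sup>+)"
    by simp
  then have fin: "finite {w. (w, v) \<in> ?E\<^sup>+}"
    by (rule finite_subset[rotated]) force
  have "{w. (w, u) \<in> ?E\<^sup>+} \<subset> {w. (w, v) \<in> ?E\<^sup>+}"
  proof
    show "{w. (w, u) \<in> ?E\<^sup>+} \<subseteq> {w. (w, v) \<in> ?E\<^sup>+}"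
      using e by (auto intro: trancl_into_trancl)
    have "u \<in> {w. (w, v) \<in> ?E\<^sup>+}" "u \<notin> {w. (w, u) \<in> ?E\<^sup>+}"
      using e ac by (auto simp: acyclic_def)
    then show "{w. (w, u) \<in> ?E\<^sup>+} \<noteq> {w. (w, v) \<in> ?E\<^sup>+}"
      by blast
  qed
  then show ?thesis
    unfolding var_rank_def by (rule psubset_card_mono[OF fin])
qed

lemma sform_rank_Var: "sform_rank P (Var p) = Suc (var_rank P p)"
  by (simp add: sform_rank_def)

lemma sform_rank_mono: "vars_sform \<phi> \<subseteq> vars_sform \<psi> \<Longrightarrow> sform_rank P \<phi> \<le> sform_rank P \<psi>"
  unfolding sform_rank_def by (intro Max_mono) auto

lemma sform_rank_less:
  assumes "program P" and "r \<in> P" and "p \<in> rule_head r" and "vars_sform \<phi> \<subseteq> rule_body r"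
  shows "sform_rank P \<phi> < sform_rank P (Var p)"
proof -
  have "var_rank P v < var_rank P p" if "v \<in> vars_sform \<phi>" for v
    using that assms by (intro var_rank_less) (auto simp: dep_graph_def)
  then show ?thesis
    by (auto simp: sform_rank_def)
qed

text \<open>
  Here \<open>sat P I t \<phi>\<close> stands for \<open>(P, I, t) \<Turnstile> \<phi>\<close>.  The interpretation \<open>I\<^sub>1, \<dots>, I\<^sub>\<ell>\<close> is the list \<open>I\<close>,
  so \<open>I\<^sub>t\<close> is \<open>I ! (t - 1)\<close>; likewise state \<open>i\<close> of an operator corresponds to the head variable
  \<open>ps ! (i - 1)\<close>.  Time \<open>0\<close> precedes the first letter: input variables are false there, and so
  is a variable defined by a delay rule, there being no earlier time.  The guard \<open>program P\<close>
  ensures termination and is of no significance, since only programs are considered.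
\<close>

context
  notes conj_cong [fundef_cong]
begin

function sat :: "rule set \<Rightarrow> var set list \<Rightarrow> nat \<Rightarrow> sform \<Rightarrow> bool" where
  "sat P I t Top \<longleftrightarrow> True"
| "sat P I t Bot \<longleftrightarrow> False"
| "sat P I t (Neg \<phi>) \<longleftrightarrow> \<not> sat P I t \<phi>"
| "sat P I t (And \<phi> \<psi>) \<longleftrightarrow> sat P I t \<phi> \<and> sat P I t \<psi>"
| "sat P I t (Or \<phi> \<psi>) \<longleftrightarrow> sat P I t \<phi> \<or> sat P I t \<psi>"
| "sat P I t (Var p) \<longleftrightarrow> program P \<and>
     ((p \<notin> defined_vars P \<and> 1 \<le> t \<and> t \<le> length I \<and> p \<in> I ! (t - 1)) \<or>
      (\<exists>\<alpha>. Static p \<alpha> \<in> P \<and> sat P I t \<alpha>) \<or>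
      (\<exists>q. Delay p q \<in> P \<and> 0 < t \<and> sat P I (t - 1) (Var q)) \<or>
      (\<exists>ps A as i. Dynamic ps A as \<in> P \<and> i \<in> {1..states A} \<and> p = ps ! (i - 1) \<and>
         (if t = 0 then init A = i
          else \<exists>j \<sigma>. j \<in> {1..states A} \<and> \<sigma> \<in> bools (arity A) \<and> delta A j \<sigma> = i \<and>
                 sat P I (t - 1) (Var (ps ! (j - 1))) \<and>
                 (\<forall>k\<in>{..<arity A}. sat P I t (Var (as ! k)) \<longleftrightarrow> \<sigma> ! k))))"
  by pat_completeness auto

termination
proof (relation "measures [\<lambda>(P, I, t, \<phi>). t, \<lambda>(P, I, t, \<phi>). sform_rank P \<phi>,
    \<lambda>(P, I, t, \<phi>). size \<phi>]", goal_cases)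
  case 1
  show ?case by simp
next
  case (7 P I t p \<alpha>)
  then show ?case using sform_rank_less[of P "Static p \<alpha>" p \<alpha>] by simp
next
  case (10 P I t p ps A as i j \<sigma> k)
  then have "wf_rule (Dynamic ps A as)"
    by (auto simp: program_def)
  then have "p \<in> set ps" "as ! k \<in> set as"
    using 10 by auto
  then show ?case
    using 10 sform_rank_less[of P "Dynamic ps A as" p "Var (as ! k)"] by simp
qed (auto simp: le_less[symmetric] intro!: sform_rank_mono)

end

declare sat.simps(6) [simp del]

text \<open>For programs, the clause for variables amounts to the following four.\<close>

lemma program_unique_rule:
  assumes "program P" "r \<in> P" "r' \<in> P" "p \<in> rule_head r" "p \<in> rule_head r'"
  shows "r' = r"
  using assms unfolding program_def definitorial_def by blast

lemma head_defined_var: "r \<in> P \<Longrightarrow> p \<in> rule_head r \<Longrightarrow> p \<in> defined_vars P"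
  by (auto simp: defined_vars_def)

lemma program_Dynamic:
  assumes "program P" "Dynamic ps A as \<in> P"
  shows "length ps = states A" "distinct ps" "length as = arity A" "wf_automaton A"
  using assms by (auto simp: program_def)

lemma sat_input:
  assumes "program P" and "p \<notin> defined_vars P"
  shows "sat P I t (Var p) \<longleftrightarrow> 1 \<le> t \<and> t \<le> length I \<and> p \<in> I ! (t - 1)"
proof -
  have "p \<notin> rule_head r" if "r \<in> P" for r
    using assms(2) head_defined_var that by blast
  then have "Static p \<alpha> \<notin> P" "Delay p q \<notin> P" for \<alpha> q
    by fastforce+
  moreover have "p \<noteq> ps ! (i - 1)" if "Dynamic ps A as \<in> P" "i \<in> {1..states A}" for ps A as i
  proof -
    have "ps ! (i - 1) \<in> set ps"
      using program_Dynamic(1)[OF assms(1) that(1)] that(2) by auto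
    then show ?thesis
      using head_defined_var[OF that(1)] assms(2) by auto
  qed
  ultimately show ?thesis
    using assms by (subst sat.simps(6)) blast
qed

lemma sat_static:
  assumes "program P" and "Static p \<alpha> \<in> P"
  shows "sat P I t (Var p) \<longleftrightarrow> sat P I t \<alpha>"
proof -
  have u: "r = Static p \<alpha>" if "r \<in> P" "p \<in> rule_head r" for r
    using program_unique_rule[OF assms that(1)] that by simp
  have "p \<in> defined_vars P"
    using head_defined_var[OF assms(2)] by simp
  moreover have "Static p \<beta> \<in> P \<longleftrightarrow> \<beta> = \<alpha>" "Delay p q \<notin> P" for \<beta> q
    using u[of "Static p \<beta>"] u[of "Delay p q"] assms(2) by auto
  moreover have "p \<noteq> ps ! (i - 1)" if "Dynamic ps A as \<in> P" "i \<in> {1..states A}" for ps A as i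
    using program_Dynamic(1)[OF assms(1) that(1)] that(2) u[OF that(1)] by auto
  ultimately show ?thesis
    using assms(1) by (subst sat.simps(6)) (simp del: atLeastAtMost_iff cong: conj_cong)
qed

lemma sat_delay:
  assumes "program P" and "Delay p q \<in> P"
  shows "sat P I t (Var p) \<longleftrightarrow> 0 < t \<and> sat P I (t - 1) (Var q)"
proof -
  have u: "r = Delay p q" if "r \<in> P" "p \<in> rule_head r" for r
    using program_unique_rule[OF assms that(1)] that by simp
  have "p \<in> defined_vars P"
    using head_defined_var[OF assms(2)] by simp
  moreover have "Static p \<beta> \<notin> P" "Delay p q' \<in> P \<longleftrightarrow> q' = q" for \<beta> q'
    using u[of "Static p \<beta>"] u[of "Delay p q'"] assms(2) by auto
  moreover have "p \<noteq> ps ! (i - 1)" if "Dynamic ps A as \<in> P" "i \<in> {1..states A}" for ps A as i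
    using program_Dynamic(1)[OF assms(1) that(1)] that(2) u[OF that(1)] by auto
  ultimately show ?thesis
    using assms(1) by (subst sat.simps(6)) (simp del: atLeastAtMost_iff cong: conj_cong)
qed

lemma sat_dynamic:
  assumes "program P" and D: "Dynamic ps A as \<in> P" and i: "i \<in> {1..states A}"
  shows "sat P I t (Var (ps ! (i - 1))) \<longleftrightarrow>
    (if t = 0 then init A = i
     else \<exists>j \<sigma>. j \<in> {1..states A} \<and> \<sigma> \<in> bools (arity A) \<and> delta A j \<sigma> = i \<and>
            sat P I (t - 1) (Var (ps ! (j - 1))) \<and>
            (\<forall>k\<in>{..<arity A}. sat P I t (Var (as ! k)) \<longleftrightarrow> \<sigma> ! k))"
    (is "_ \<longleftrightarrow> ?R")
proof -
  let ?p = "ps ! (i - 1)"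
  have p: "?p \<in> rule_head (Dynamic ps A as)"
    using program_Dynamic(1)[OF assms(1,2)] i by auto
  then have u: "r = Dynamic ps A as" if "r \<in> P" "?p \<in> rule_head r" for r
    using program_unique_rule[OF assms(1,2) that(1)] that by simp
  have d: "?p \<in> defined_vars P"
    using head_defined_var[OF D] p by simp
  have n: "Static ?p \<beta> \<notin> P" "Delay ?p q \<notin> P" for \<beta> q
    using u[of "Static ?p \<beta>"] u[of "Delay ?p q"] by auto
  have e: "ps' = ps \<and> A' = A \<and> as' = as \<and> i' = i"
    if "Dynamic ps' A' as' \<in> P" "i' \<in> {1..states A'}" "?p = ps' ! (i' - 1)" for ps' A' as' i'
  proof -
    have "?p \<in> set ps'"
      using program_Dynamic(1)[OF assms(1) that(1)] that(2,3) by auto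
    then have eq: "ps' = ps \<and> A' = A \<and> as' = as"
      using u[OF that(1)] by simp
    then have "i - 1 = i' - 1"
      using that i program_Dynamic(1,2)[OF assms(1) D] by (auto simp: nth_eq_iff_index_eq)
    then show ?thesis
      using eq that(2) i by auto
  qed
  show ?thesis
  proof
    assume "sat P I t (Var ?p)"
    then obtain ps' A' as' i' where
      *: "Dynamic ps' A' as' \<in> P" "i' \<in> {1..states A'}" "?p = ps' ! (i' - 1)" and
      R: "if t = 0 then init A' = i'
          else \<exists>j \<sigma>. j \<in> {1..states A'} \<and> \<sigma> \<in> bools (arity A') \<and> delta A' j \<sigma> = i' \<and>
                 sat P I (t - 1) (Var (ps' ! (j - 1))) \<and>
                 (\<forall>k\<in>{..<arity A'}. sat P I t (Var (as' ! k)) \<longleftrightarrow> \<sigma> ! k)"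
      using d n by (subst (asm) sat.simps(6)) blast
    show ?R
      using R e[OF *] by (simp only:)
  next
    assume ?R
    then show "sat P I t (Var ?p)"
      using assms(1) D i by (subst sat.simps(6)) blast
  qed
qed


section \<open>Logics and expressivity\<close>

definition KR_logic :: "op_automaton set \<Rightarrow> rule set set" where
  "KR_logic \<A> = {P. program P \<and> (\<forall>ps A as. Dynamic ps A as \<in> P \<longrightarrow> A \<in> \<A>)}"

fun flip_flop_delta :: "nat \<Rightarrow> bool list \<Rightarrow> nat" where
  "flip_flop_delta q [False, False] = q"
| "flip_flop_delta q [True, _] = 2"
| "flip_flop_delta q [False, True] = 1"
| "flip_flop_delta q _ = q"

definition flip_flop :: op_automaton where
  "flip_flop = \<lparr>arity = 2, states = 2, delta = flip_flop_delta, init = 1\<rparr>"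

definition letter_interp :: "var list \<Rightarrow> bool list \<Rightarrow> var set" where
  "letter_interp xs \<sigma> = {xs ! k | k. k < length xs \<and> \<sigma> ! k}"

text \<open>
  The language recognised by the program \<open>P\<close> with ordered input variables \<open>xs\<close> and designated
  variable \<open>a\<close>.  Interpretations are non-empty, hence so are the recognised strings.
\<close>

definition recognised_language :: "rule set \<Rightarrow> var list \<Rightarrow> var \<Rightarrow> bool list list set" where
  "recognised_language P xs a =
     {w \<in> lists (bools (length xs)). w \<noteq> [] \<and>
        sat P (map (letter_interp xs) w) (length w) (Var a)}"

text \<open>
  A logic is a set of programs.  Its expressivity is given separately for each number \<open>m\<close> of
  input variables, i.e. for each alphabet \<open>\<bool>\<^sup>m\<close>.
\<close>

definition expressivity :: "rule set set \<Rightarrow> nat \<Rightarrow> bool list list set set" where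
  "expressivity \<L> m =
     {recognised_language P xs a | P xs a.
        P \<in> \<L> \<and> length xs = m \<and> distinct xs \<and> set xs = input_vars P \<and> a \<in> vars P}"


section \<open>Star-free languages\<close>

datatype 'a sf_regexp =
    Empty
  | Letter 'a
  | Union "'a sf_regexp" "'a sf_regexp"
  | Concat "'a sf_regexp" "'a sf_regexp"
  | Compl "'a sf_regexp"

primrec sf_lang :: "'a set \<Rightarrow> 'a sf_regexp \<Rightarrow> 'a list set" where
  "sf_lang \<Sigma> Empty = {}"
| "sf_lang \<Sigma> (Letter c) = {[c]}"
| "sf_lang \<Sigma> (Union r s) = sf_lang \<Sigma> r \<union> sf_lang \<Sigma> s"
| "sf_lang \<Sigma> (Concat r s) = {u @ v | u v. u \<in> sf_lang \<Sigma> r \<and> v \<in> sf_lang \<Sigma> s}"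
| "sf_lang \<Sigma> (Compl r) = lists \<Sigma> - sf_lang \<Sigma> r"

text \<open>The set \<open>set_sf_regexp r\<close> consists of the letters occurring in \<open>r\<close>.\<close>

definition star_free :: "'a set \<Rightarrow> 'a list set \<Rightarrow> bool" where
  "star_free \<Sigma> L \<longleftrightarrow> (\<exists>r. set_sf_regexp r \<subseteq> \<Sigma> \<and> L = sf_lang \<Sigma> r)"

end

theory Submission
  imports Defs "HOL-Library.FuncSet"
begin

text \<open>
  Both classes coincide with the least class of languages that contains the conditions on the last
  letter and is closed under Boolean operations, delay and the flip-flop.  Programs compute exactly
  these, variable by variable.  Such a language is star-free: if \<open>L\<close> is star-free, then
  \<open>{(u, v). u @ v \<in> L}\<close> is a finite union of products of star-free languages, and these relations
  form a Boolean algebra in which the flip-flop condition on a factorisation can be stated.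
  Conversely, the quotients of a star-free language form a finite counter-free automaton, which is
  decomposed by an induction on the number of states and of letters due to Wilke.
\<close>

section \<open>Past-definable languages\<close>

text \<open>Star-free expressions can guess a factorisation but treat its factors separately,
  whereas the flip-flop condition, no reset since the last set, speaks about all prefixes of the
  second factor while remembering the first. Binary relations keep both factors in view: the pairs
  with a harmful reset are described existentially and then complemented, and only at the end are
  the two factors joined.

  In the other direction the obstacle is that a past operator sees the whole prefix and never a
  factor on its own. A letter \<open>c\<close> serves as a visible marker: if \<open>c\<close>
  clears every operator, the current block is read as though it were a fresh word; if flip-flops
  change only at \<open>c\<close>, whole blocks act as letters. These two relativisations are
  \<open>past_definable_restart\<close> and \<open>past_definable_blocks\<close>; one serves the
  runs inside a block, the other the run over the blocks.

  The empty word stands for time \<open>0\<close>, at which delayed variables and state 2 of a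
  flip-flop are false. Past-definable languages may therefore contain it, although recognised
  strings are non-empty.\<close>

inductive_set latch :: "'a list set \<Rightarrow> 'a list set \<Rightarrow> 'a list set" for S R where
  set: "w @ [a] \<in> S \<Longrightarrow> w @ [a] \<in> latch S R"
| keep: "w \<in> latch S R \<Longrightarrow> w @ [a] \<notin> R \<Longrightarrow> w @ [a] \<in> latch S R"

definition delay :: "'a list set \<Rightarrow> 'a list set" where
  "delay L = {w @ [a] | w a. w \<in> L}"

definition ends_in :: "'a set \<Rightarrow> 'a list set" where
  "ends_in X = {w @ [a] | w a. a \<in> X}"

text \<open>No alphabet is fixed and complements are taken among all words over the type, because
  the decomposition of automata changes the alphabet when blocks become letters. Restriction to an
  alphabet is recovered in \<open>past_definable_lists\<close>.\<close>

inductive past_definable :: "'a list set \<Rightarrow> bool" where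
  ends_in: "past_definable (ends_in X)"
| Compl: "past_definable L \<Longrightarrow> past_definable (- L)"
| Un: "past_definable L \<Longrightarrow> past_definable L' \<Longrightarrow> past_definable (L \<union> L')"
| delay: "past_definable L \<Longrightarrow> past_definable (delay L)"
| latch: "past_definable S \<Longrightarrow> past_definable R \<Longrightarrow> past_definable (latch S R)"

lemma Nil_notin [simp]: "[] \<notin> latch S R" "[] \<notin> delay L" "[] \<notin> ends_in X"
  by (auto simp: delay_def ends_in_def elim: latch.cases)

lemma snoc_delay [simp]: "w @ [a] \<in> delay L \<longleftrightarrow> w \<in> L"
  by (auto simp: delay_def)

lemma snoc_ends_in [simp]: "w @ [a] \<in> ends_in X \<longleftrightarrow> a \<in> X"
  by (auto simp: ends_in_def)

text \<open>Setting wins over resetting, as the flip-flop moves to state 2 on input 11. Read as a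
  recursion on the last letter, the equation is the satisfaction clause for state 2; the absence of
  the empty word matches the initial state 1.\<close>

lemma snoc_latch: "w @ [a] \<in> latch S R \<longleftrightarrow> w @ [a] \<in> S \<or> w @ [a] \<notin> R \<and> w \<in> latch S R"
  by (auto elim: latch.cases intro: latch.intros)

lemma past_definable_Int:
  "past_definable L \<Longrightarrow> past_definable L' \<Longrightarrow> past_definable (L \<inter> L')"
proof -
  assume "past_definable L" "past_definable L'"
  then have "past_definable (- (- L \<union> - L'))"
    by (intro past_definable.Compl past_definable.Un)
  then show ?thesis
    by simp
qed

lemma past_definable_Diff:
  "past_definable L \<Longrightarrow> past_definable L' \<Longrightarrow> past_definable (L - L')"
  unfolding Diff_eq by (intro past_definable_Int past_definable.Compl)

lemma past_definable_empty: "past_definable {}"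
proof -
  have "ends_in {} = ({} :: 'a list set)"
    by (simp add: ends_in_def)
  then show ?thesis
    using past_definable.ends_in[of "{}"] by metis
qed

lemma past_definable_UNIV: "past_definable UNIV"
  using past_definable.Compl[OF past_definable_empty] by simp

lemma past_definable_UN:
  "finite F \<Longrightarrow> (\<And>i. i \<in> F \<Longrightarrow> past_definable (L i)) \<Longrightarrow> past_definable (\<Union>i\<in>F. L i)"
  by (induction F rule: finite_induct)
    (auto intro: past_definable_empty past_definable.Un)

lemma past_definable_INT:
  assumes "finite F" "\<And>i. i \<in> F \<Longrightarrow> past_definable (L i)"
  shows "past_definable (\<Inter>i\<in>F. L i)"
proof -
  have "(\<Inter>i\<in>F. L i) = - (\<Union>i\<in>F. - L i)"
    by simp
  then show ?thesis
    using assms past_definable_UN past_definable.Compl by metis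
qed

text \<open>Without resets a flip-flop is the temporal operator "once". The empty prefix is excluded
  because nothing can be set before the first letter.\<close>

lemma latch_empty_iff: "w \<in> latch S {} \<longleftrightarrow> (\<exists>u v. w = u @ v \<and> u \<in> S \<and> u \<noteq> [])"
proof (induction w rule: rev_induct)
  case (snoc a w)
  have "(\<exists>u v. w @ [a] = u @ v \<and> u \<in> S \<and> u \<noteq> []) \<longleftrightarrow>
      w @ [a] \<in> S \<or> (\<exists>u v. w = u @ v \<and> u \<in> S \<and> u \<noteq> [])" (is "?l \<longleftrightarrow> ?r")
  proof
    assume ?l
    then obtain u v where "w @ [a] = u @ v" "u \<in> S" "u \<noteq> []"
      by blast
    then show ?r
      by (cases v rule: rev_cases) auto
  next
    assume ?r
    then show ?l
      by (metis append.right_neutral append_assoc snoc_eq_iff_butlast)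
  qed
  then show ?case
    using snoc by (simp add: snoc_latch)
qed simp

lemma past_definable_lists: "past_definable (lists B)"
proof -
  \<comment> \<open>A letter outside \<open>B\<close> sets a flip-flop that is never reset.\<close>
  have "w \<in> lists B \<longleftrightarrow> w \<notin> latch (ends_in (- B)) {}" for w
    by (induction w rule: rev_induct) (auto simp: snoc_latch)
  then have "lists B = - latch (ends_in (- B)) {}"
    by blast
  then show ?thesis
    by (metis past_definable.intros(1,2,5) past_definable_empty)
qed

text \<open>A letter-to-letter map preserves the prefix structure, so every operator commutes with
  the inverse image. This brings the result on automata, whose letters are functions, back to the
  original alphabet.\<close>

lemma past_definable_vimage_map: "past_definable L \<Longrightarrow> past_definable {w. map \<phi> w \<in> L}"
proof (induction rule: past_definable.induct)
  case (ends_in X)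
  have "map \<phi> w \<in> ends_in X \<longleftrightarrow> w \<in> ends_in (\<phi> -` X)" for w
    by (cases w rule: rev_cases) auto
  then show ?case
    by (simp add: past_definable.ends_in)
next
  case (Compl L)
  have "{w. map \<phi> w \<in> - L} = - {w. map \<phi> w \<in> L}"
    by blast
  then show ?case
    using Compl past_definable.Compl by metis
next
  case (Un L L')
  have "{w. map \<phi> w \<in> L \<union> L'} = {w. map \<phi> w \<in> L} \<union> {w. map \<phi> w \<in> L'}"
    by blast
  then show ?case
    using Un past_definable.Un by metis
next
  case (delay L)
  have "map \<phi> w \<in> delay L \<longleftrightarrow> w \<in> delay {w. map \<phi> w \<in> L}" for w
    by (cases w rule: rev_cases) auto
  then show ?case
    using delay by (simp add: past_definable.delay)
next
  case (latch S R)
  have "map \<phi> w \<in> latch S R \<longleftrightarrow> w \<in> latch {w. map \<phi> w \<in> S} {w. map \<phi> w \<in> R}" for w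
    by (induction w rule: rev_induct) (auto simp: snoc_latch)
  then show ?case
    using latch by (simp add: past_definable.latch)
qed

section \<open>Words split into blocks by a letter\<close>

text \<open>Evaluates \<open>L\<close> on what follows the last \<open>c\<close>. A prefix ending in
  \<open>c\<close> then has to behave like the empty word, which lies in no \<open>ends_in\<close>,
  \<open>delay\<close> or \<open>latch\<close>; so each of these three operators is forced to be
  false at \<open>c\<close>.\<close>

lemma past_definable_restart:
  assumes "past_definable L"
  shows "\<exists>L'. past_definable L' \<and> (\<forall>u v. c \<notin> set v \<longrightarrow> (u @ c # v \<in> L' \<longleftrightarrow> v \<in> L))"
  using assms
proof (induction rule: past_definable.induct)
  case (ends_in X)
  have "u @ c # v \<in> ends_in (X - {c}) \<longleftrightarrow> v \<in> ends_in X" if "c \<notin> set v" for u v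
    using that snoc_ends_in[of "u @ c # butlast v" "last v"] by (cases v rule: rev_cases) auto
  then show ?case
    using past_definable.ends_in by blast
next
  case (Compl L)
  then show ?case
    using past_definable.Compl by (metis Compl_iff)
next
  case (Un L1 L2)
  then obtain L1' L2' where "past_definable L1'" "past_definable L2'"
    "\<And>u v. c \<notin> set v \<Longrightarrow> u @ c # v \<in> L1' \<longleftrightarrow> v \<in> L1"
    "\<And>u v. c \<notin> set v \<Longrightarrow> u @ c # v \<in> L2' \<longleftrightarrow> v \<in> L2"
    by blast
  then show ?case
    by (intro exI[of _ "L1' \<union> L2'"]) (simp add: past_definable.Un)
next
  case (delay L)
  then obtain L' where L': "past_definable L'" "\<And>u v. c \<notin> set v \<Longrightarrow> u @ c # v \<in> L' \<longleftrightarrow> v \<in> L"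
    by blast
  have "u @ c # v \<in> delay L' - ends_in {c} \<longleftrightarrow> v \<in> delay L" if "c \<notin> set v" for u v
    using that L'(2) snoc_delay[of "u @ c # butlast v" "last v"]
      snoc_ends_in[of "u @ c # butlast v" "last v"]
    by (cases v rule: rev_cases) auto
  then show ?case
    using L'(1)
    by (intro exI[of _ "delay L' - ends_in {c}"] conjI allI impI past_definable_Diff
        past_definable.delay past_definable.ends_in)
next
  case (latch S R)
  then obtain S' R' where SR': "past_definable S'" "past_definable R'"
    "\<And>u v. c \<notin> set v \<Longrightarrow> u @ c # v \<in> S' \<longleftrightarrow> v \<in> S"
    "\<And>u v. c \<notin> set v \<Longrightarrow> u @ c # v \<in> R' \<longleftrightarrow> v \<in> R"
    by blast
  let ?L = "latch (S' - ends_in {c}) (R' \<union> ends_in {c})"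
  have "u @ c # v \<in> ?L \<longleftrightarrow> v \<in> latch S R" if "c \<notin> set v" for u v
    using that
  proof (induction v rule: rev_induct)
    case (snoc a v)
    then show ?case
      using SR'(3,4)[of "v @ [a]" u] snoc_latch[of "u @ c # v" a]
        snoc_ends_in[of "u @ c # v" a] by (auto simp: snoc_latch)
  qed (simp add: snoc_latch)
  then show ?case
    using SR'(1,2)
    by (intro exI[of _ ?L] conjI allI impI past_definable.latch past_definable_Diff
        past_definable.Un past_definable.ends_in)
qed

text \<open>\<open>blocks c w\<^sub>0 [w\<^sub>1, \<dots>, w\<^sub>k] v\<close> is the word \<open>w\<^sub>0 c w\<^sub>1 c \<dots> w\<^sub>k c v\<close>.\<close>

definition blocks :: "'a \<Rightarrow> 'a list \<Rightarrow> 'a list list \<Rightarrow> 'a list \<Rightarrow> 'a list" where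
  "blocks c w0 ws v = w0 @ c # concat (map (\<lambda>x. x @ [c]) ws) @ v"

lemma blocks_snoc: "blocks c w0 ws (v @ [a]) = blocks c w0 ws v @ [a]"
  by (simp add: blocks_def)

lemma blocks_Nil_Nil: "blocks c w0 [] [] = w0 @ [c]"
  by (simp add: blocks_def)

lemma blocks_snoc_Nil: "blocks c w0 (ws @ [x]) [] = blocks c w0 ws x @ [c]"
  by (simp add: blocks_def)

lemma blocks_append: "blocks c w0 ws v = blocks c w0 ws [] @ v"
  by (simp add: blocks_def)

text \<open>With or without blocks, the remainder \<open>v\<close> comes right after a
  \<open>c\<close>; this is the shape to which \<open>past_definable_restart\<close>
  applies.\<close>

lemma blocks_last: "\<exists>u. \<forall>v. blocks c w0 ws v = u @ c # v"
proof (cases ws rule: rev_cases)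
  case Nil
  then show ?thesis
    by (auto simp: blocks_def)
next
  case (snoc ws' x)
  then show ?thesis
    by (intro exI[of _ "blocks c w0 ws' x"]) (simp add: blocks_def)
qed

lemma blocks_exist:
  assumes "w \<in> lists A" "c \<in> set w"
  obtains w0 ws v where "w0 \<in> lists (A - {c})" "ws \<in> lists (lists (A - {c}))"
    "v \<in> lists (A - {c})" "w = blocks c w0 ws v"
proof -
  have "\<exists>w0 ws v. w0 \<in> lists (A - {c}) \<and> ws \<in> lists (lists (A - {c})) \<and>
      v \<in> lists (A - {c}) \<and> w = blocks c w0 ws v"
    using assms
  proof (induction w rule: rev_induct)
    case (snoc a w)
    show ?case
    proof (cases "c \<in> set w")
      case True
      have "w \<in> lists A"
        using snoc.prems(1) by simp
      from snoc.IH[OF this True] obtain w0 ws v where *: "w0 \<in> lists (A - {c})"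
        "ws \<in> lists (lists (A - {c}))" "v \<in> lists (A - {c})" "w = blocks c w0 ws v"
        by blast
      show ?thesis
      proof (cases "a = c")
        case True
        then have "w @ [a] = blocks c w0 (ws @ [v]) []"
          using * by (simp add: blocks_snoc_Nil)
        moreover have "ws @ [v] \<in> lists (lists (A - {c}))"
          using * by simp
        ultimately show ?thesis
          using *(1) by blast
      next
        case False
        then have "w @ [a] = blocks c w0 ws (v @ [a])" "v @ [a] \<in> lists (A - {c})"
          using * snoc.prems by (auto simp: blocks_snoc)
        then show ?thesis
          using *(1,2) by blast
      qed
    next
      case False
      then have "w @ [a] = blocks c w [] []" "w \<in> lists (A - {c})"
        using snoc.prems by (auto simp: blocks_def)
      then show ?thesis
        by blast
    qed
  qed simp
  then show ?thesis
    using that by blast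
qed

text \<open>Both inputs are off at every letter other than \<open>c\<close>, so the state can change
  at \<open>c\<close> only.\<close>

lemma latch_ignore:
  assumes "c \<notin> set v"
  shows "u @ v \<in> latch (S \<inter> ends_in {c}) (R \<inter> ends_in {c}) \<longleftrightarrow>
    u \<in> latch (S \<inter> ends_in {c}) (R \<inter> ends_in {c})"
  using assms
proof (induction v rule: rev_induct)
  case (snoc a v)
  then show ?case
    by (auto simp: snoc_latch simp flip: append_assoc)
qed simp

lemma blocks_latch:
  assumes "c \<notin> set v"
  shows "blocks c w0 ws v \<in> latch (S \<inter> ends_in {c}) (R \<inter> ends_in {c}) \<longleftrightarrow>
    blocks c w0 ws [] \<in> latch (S \<inter> ends_in {c}) (R \<inter> ends_in {c})"
  using latch_ignore[OF assms] by (metis blocks_append)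

text \<open>Sample and hold: each \<open>c\<close> resets the flip-flop and, since setting wins,
  leaves it with the value of \<open>L\<close> at the latest \<open>c\<close>.\<close>

definition sample :: "'a \<Rightarrow> 'a list set \<Rightarrow> 'a list set" where
  "sample c L = latch (L \<inter> ends_in {c}) (UNIV \<inter> ends_in {c})"

lemma past_definable_sample: "past_definable L \<Longrightarrow> past_definable (sample c L)"
  unfolding sample_def
  by (intro past_definable.latch past_definable_Int past_definable.ends_in past_definable_UNIV)

lemma blocks_sample:
  assumes "c \<notin> set v"
  shows "blocks c w0 ws v \<in> sample c L \<longleftrightarrow> blocks c w0 ws [] \<in> L"
proof -
  obtain u where u: "blocks c w0 ws [] = u @ [c]"
    using blocks_last by metis
  show ?thesis
    unfolding sample_def blocks_latch[OF assms] by (simp add: u snoc_latch)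
qed

definition seen :: "'a \<Rightarrow> 'a list set" where
  "seen c = {w. c \<in> set w}"

lemma past_definable_seen: "past_definable (seen c)"
proof -
  have "seen c = - lists (- {c})"
    by (auto simp: seen_def)
  then show ?thesis
    using past_definable.Compl past_definable_lists by metis
qed

lemma blocks_seen [simp]: "blocks c w0 ws v \<in> seen c"
  by (simp add: seen_def blocks_def)

text \<open>Runs the operators on a slower clock that ticks at \<open>c\<close> and holds values in
  between, whence the independence of \<open>v\<close>. The first \<open>c\<close> closes
  \<open>w0\<close>, which is not a block, and stands for the empty word of blocks.\<close>

lemma past_definable_blocks:
  fixes B :: "'a set" and f :: "'a list \<Rightarrow> 'b"
  assumes c: "c \<notin> B" and f: "\<And>X. past_definable {x \<in> lists B. f x \<in> X}"
    and K: "past_definable K"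
  shows "\<exists>K'. past_definable K' \<and>
    (\<forall>w0\<in>lists B. \<forall>ws\<in>lists (lists B). \<forall>v\<in>lists B. blocks c w0 ws v \<in> K' \<longleftrightarrow> map f ws \<in> K)"
  using K
proof (induction rule: past_definable.induct)
  case (ends_in X)
  obtain X' where X': "past_definable X'"
    "\<And>u x. c \<notin> set x \<Longrightarrow> u @ c # x \<in> X' \<longleftrightarrow> x \<in> {x \<in> lists B. f x \<in> X}"
    using past_definable_restart[OF f[of X], of c] by blast
  \<comment> \<open>The block closed by a \<open>c\<close> ends one letter earlier, hence
    \<open>delay X'\<close>. The conjunct \<open>delay (seen c)\<close> excludes the first
    \<open>c\<close>, which closes \<open>w0\<close>.\<close>
  let ?K = "sample c (delay X' \<inter> delay (seen c))"
  have "blocks c w0 ws v \<in> ?K \<longleftrightarrow> map f ws \<in> ends_in X"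
    if "w0 \<in> lists B" "ws \<in> lists (lists B)" "v \<in> lists B" for w0 ws v
  proof -
    have v: "c \<notin> set v" and w0: "c \<notin> set w0"
      using that c by auto
    show ?thesis
    proof (cases ws rule: rev_cases)
      case Nil
      then show ?thesis
        using w0 by (simp add: blocks_sample[OF v] blocks_Nil_Nil seen_def)
    next
      case (snoc ws' x)
      then have x: "x \<in> lists B" "c \<notin> set x"
        using that c by auto
      obtain u where "blocks c w0 ws' x = u @ c # x"
        using blocks_last by metis
      then have "blocks c w0 ws' x \<in> X' \<longleftrightarrow> f x \<in> X"
        using X'(2) x by simp
      then show ?thesis
        using snoc by (simp add: blocks_sample[OF v] blocks_snoc_Nil)
    qed
  qed
  then show ?case
    using X'(1)
    by (intro exI[of _ ?K] conjI ballI past_definable_sample past_definable_Int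
        past_definable.delay past_definable_seen)
next
  case (Compl K)
  then obtain K' where "past_definable K'"
    "\<forall>w0\<in>lists B. \<forall>ws\<in>lists (lists B). \<forall>v\<in>lists B.
      blocks c w0 ws v \<in> K' \<longleftrightarrow> map f ws \<in> K"
    by blast
  then show ?case
    by (intro exI[of _ "- K'"]) (simp add: past_definable.Compl)
next
  case (Un K1 K2)
  from Un.IH(1) obtain K1' where 1: "past_definable K1'"
    "\<forall>w0\<in>lists B. \<forall>ws\<in>lists (lists B). \<forall>v\<in>lists B.
      blocks c w0 ws v \<in> K1' \<longleftrightarrow> map f ws \<in> K1"
    by blast
  from Un.IH(2) obtain K2' where 2: "past_definable K2'"
    "\<forall>w0\<in>lists B. \<forall>ws\<in>lists (lists B). \<forall>v\<in>lists B.
      blocks c w0 ws v \<in> K2' \<longleftrightarrow> map f ws \<in> K2"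
    by blast
  then show ?case
    using 1 by (intro exI[of _ "K1' \<union> K2'"]) (simp add: past_definable.Un)
next
  case (delay K)
  then obtain K' where K': "past_definable K'"
    "\<forall>w0\<in>lists B. \<forall>ws\<in>lists (lists B). \<forall>v\<in>lists B.
      blocks c w0 ws v \<in> K' \<longleftrightarrow> map f ws \<in> K"
    by blast
  \<comment> \<open>Just before the \<open>c\<close> that closes a block, \<open>K'\<close> still
    has the value held since the previous \<open>c\<close>; \<open>seen c\<close> ensures that there
    was one.\<close>
  let ?K = "sample c (delay (K' \<inter> seen c))"
  have "blocks c w0 ws v \<in> ?K \<longleftrightarrow> map f ws \<in> delay K"
    if "w0 \<in> lists B" "ws \<in> lists (lists B)" "v \<in> lists B" for w0 ws v
  proof -
    have v: "c \<notin> set v" and w0: "c \<notin> set w0"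
      using that c by auto
    show ?thesis
    proof (cases ws rule: rev_cases)
      case Nil
      then show ?thesis
        using w0 by (simp add: blocks_sample[OF v] blocks_Nil_Nil seen_def)
    next
      case (snoc ws' x)
      then have "ws' \<in> lists (lists B)" "x \<in> lists B"
        using that by auto
      then show ?thesis
        using snoc that K'(2) by (simp add: blocks_sample[OF v] blocks_snoc_Nil)
    qed
  qed
  then show ?case
    using K'(1)
    by (intro exI[of _ ?K] conjI ballI past_definable_sample past_definable_Int
        past_definable.delay past_definable_seen)
next
  case (latch S R)
  from latch.IH(1) obtain S' where 1: "past_definable S'"
    "\<forall>w0\<in>lists B. \<forall>ws\<in>lists (lists B). \<forall>v\<in>lists B.
      blocks c w0 ws v \<in> S' \<longleftrightarrow> map f ws \<in> S"
    by blast
  from latch.IH(2) obtain R' where 2: "past_definable R'"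
    "\<forall>w0\<in>lists B. \<forall>ws\<in>lists (lists B). \<forall>v\<in>lists B.
      blocks c w0 ws v \<in> R' \<longleftrightarrow> map f ws \<in> R"
    by blast
  \<comment> \<open>Only the set input is masked at the first \<open>c\<close>: a reset there finds
    the flip-flop still off.\<close>
  let ?K = "latch (S' \<inter> delay (seen c) \<inter> ends_in {c}) (R' \<inter> ends_in {c})"
  have "blocks c w0 ws v \<in> ?K \<longleftrightarrow> map f ws \<in> latch S R"
    if "w0 \<in> lists B" "ws \<in> lists (lists B)" "v \<in> lists B" for w0 ws v
    using that
  proof (induction ws arbitrary: v rule: rev_induct)
    case Nil
    then have v: "c \<notin> set v" and w0: "c \<notin> set w0"
      using c by auto
    have "w0 \<notin> ?K"
      using latch_ignore[OF w0, of "[]"] by simp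
    then show ?case
      using w0 by (simp add: blocks_latch[OF v] blocks_Nil_Nil snoc_latch seen_def)
  next
    case (snoc x ws)
    then have v: "c \<notin> set v" and x: "x \<in> lists B" "ws \<in> lists (lists B)"
      using c by auto
    have eq: "map f (ws @ [x]) = map f ws @ [f x]"
      by simp
    have "blocks c w0 (ws @ [x]) [] \<in> S' \<longleftrightarrow> map f (ws @ [x]) \<in> S"
      "blocks c w0 (ws @ [x]) [] \<in> R' \<longleftrightarrow> map f (ws @ [x]) \<in> R"
      using 1(2) 2(2) snoc.prems by auto
    then show ?case
      using snoc.IH[of x] snoc.prems x unfolding blocks_latch[OF v] eq
      by (simp add: blocks_snoc_Nil snoc_latch)
  qed
  then show ?case
    using 1(1) 2(1)
    by (intro exI[of _ ?K] conjI ballI past_definable.latch past_definable_Int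
        past_definable.delay past_definable_seen past_definable.ends_in)
qed

section \<open>Counter-free automata\<close>

text \<open>The letters of an automaton are taken to be its transition functions.\<close>

primrec run :: "('q \<Rightarrow> 'q) list \<Rightarrow> 'q \<Rightarrow> 'q" where
  "run [] q = q"
| "run (f # w) q = run w (f q)"

lemma run_append [simp]: "run (u @ v) q = run v (run u q)"
  by (induction u arbitrary: q) auto

text \<open>Aperiodicity of the transition monoid, with an exponent that may depend on the word.
  Equality is asked on \<open>Q\<close> only, as the functions are arbitrary elsewhere.\<close>

definition counter_free :: "'q set \<Rightarrow> ('q \<Rightarrow> 'q) set \<Rightarrow> bool" where
  "counter_free Q A \<longleftrightarrow> (\<forall>f\<in>A. f ` Q \<subseteq> Q) \<and>
     (\<forall>w\<in>lists A. \<exists>n. \<forall>q\<in>Q. (run w ^^ Suc n) q = (run w ^^ n) q)"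

lemma run_singleton: "run [f] = f"
  by (rule ext) simp

lemma run_closed:
  assumes "\<forall>f\<in>A. f ` Q \<subseteq> Q" "w \<in> lists A" "q \<in> Q"
  shows "run w q \<in> Q"
  using assms(2)
proof (induction w rule: rev_induct)
  case (snoc a w)
  then show ?case
    using assms(1) by auto
qed (use assms in simp)

lemma counter_free_subset: "counter_free Q A \<Longrightarrow> B \<subseteq> A \<Longrightarrow> counter_free Q B"
  unfolding counter_free_def by (metis lists_mono subsetD)

text \<open>The power \<open>f ^^ n\<close> is injective on \<open>Q\<close>, so it can be cancelled
  from \<open>f ^^ Suc n = f ^^ n\<close>. Hence an automaton all of whose letters permute the
  states never moves, which ends the recursion.\<close>

lemma counter_free_permutation:
  assumes "finite Q" "counter_free Q A" "f \<in> A" "f ` Q = Q" "q \<in> Q"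
  shows "f q = q"
proof -
  have "[f] \<in> lists A"
    using assms(3) by simp
  then have "\<exists>n. \<forall>q\<in>Q. (run [f] ^^ Suc n) q = (run [f] ^^ n) q"
    using assms(2) unfolding counter_free_def by blast
  then obtain n where n: "\<And>q. q \<in> Q \<Longrightarrow> (f ^^ Suc n) q = (f ^^ n) q"
    unfolding run_singleton by blast
  have "inj_on f Q"
    using assms(1,4) by (simp add: eq_card_imp_inj_on)
  then have "bij_betw f Q Q"
    using assms(4) by (simp add: bij_betw_def)
  then have "bij_betw (f ^^ n) Q Q"
    by (rule bij_betw_funpow)
  moreover have "(f ^^ n) (f q) = (f ^^ n) q"
    using n[OF assms(5)] by (simp add: funpow_swap1)
  ultimately show ?thesis
    using assms(4,5) by (auto simp: bij_betw_def dest: inj_onD)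
qed

text \<open>Passes from one target state, as in the induction hypothesis, to an arbitrary set of
  target states.\<close>

lemma past_definable_transition:
  assumes "finite Q" "finite B" "p \<in> Q" "\<forall>f\<in>B. f ` Q \<subseteq> Q"
    and pd: "\<And>r. r \<in> Q \<Longrightarrow> past_definable {x \<in> lists B. run x p = r}"
  shows "past_definable {x \<in> lists B. R (run x p)}"
proof -
  have "{x \<in> lists B. R (run x p)} = (\<Union>r\<in>{r \<in> Q. R r}. {x \<in> lists B. run x p = r})"
    using run_closed[OF assms(4) _ assms(3)] by blast
  then show ?thesis
    using past_definable_UN[of "{r \<in> Q. R r}" "\<lambda>r. {x \<in> lists B. run x p = r}"] assms(1) pd
    by simp
qed

text \<open>
  A letter \<open>c\<close> that does not permute \<open>Q\<close> cuts the word into blocks without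
  \<open>c\<close>.  Within a block the alphabet is smaller; from one \<open>c\<close> to the next, the automaton stays in
  the proper subset \<open>c ` Q\<close> of \<open>Q\<close>, the blocks acting as letters.
\<close>

theorem counter_free_past_definable:
  assumes "finite Q" "finite A" "counter_free Q A" "p \<in> Q" "q \<in> Q"
  shows "past_definable {w \<in> lists A. run w p = q}"
  using assms
\<comment> \<open>The number of states is compared before the number of letters: the alphabet
  \<open>A'\<close> acting on the smaller \<open>Q'\<close> may be far larger than \<open>A\<close>,
  while a single block runs on all of \<open>Q\<close> with one letter less.\<close>
proof (induction "card Q" arbitrary: Q A p q rule: less_induct)
  case outer: less
  show ?case
    using outer.prems
  proof (induction "card A" arbitrary: A p q rule: less_induct)
    case less
    have closed: "\<forall>f\<in>A. f ` Q \<subseteq> Q"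
      using less.prems by (simp add: counter_free_def)
    show ?case
    proof (cases "\<forall>f\<in>A. f ` Q = Q")
      case True
      have "run w p = p" if "w \<in> lists A" for w
        using that
      proof (induction w)
        case (Cons f w)
        then show ?case
          using True counter_free_permutation less.prems by force
      qed simp
      then have "{w \<in> lists A. run w p = q} = (if p = q then lists A else {})"
        by auto
      then show ?thesis
        using past_definable_empty past_definable_lists by auto
    next
      case False
      then obtain c where c: "c \<in> A" "c ` Q \<noteq> Q"
        by blast
      define B where "B = A - {c}"
      define Q' where "Q' = c ` Q"
      have Q': "Q' \<subset> Q"
        using c closed by (auto simp: Q'_def)
      have "finite Q'" "card Q' < card Q"
        using less.prems(1) Q' by (auto intro: finite_subset psubset_card_mono)
      moreover have "finite B" "card B < card A" "c \<notin> B" "B \<subseteq> A"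
        using less.prems(2) c(1) card_Diff1_less[of A c] by (auto simp: B_def)
      ultimately have fin: "finite Q'" "finite B" "card Q' < card Q" "card B < card A"
        "c \<notin> B" "B \<subseteq> A"
        by blast+
      have cQ: "c r \<in> Q'" if "r \<in> Q" for r
        using that by (simp add: Q'_def)
      have closedB: "\<forall>f\<in>B. f ` Q \<subseteq> Q"
        using closed fin(6) by blast
      have runB: "run x r \<in> Q" if "x \<in> lists B" "r \<in> Q" for x r
        using run_closed[OF closedB] that by blast
      have pdB: "past_definable {x \<in> lists B. R (run x r)}" if "r \<in> Q" for r R
        using past_definable_transition[OF less.prems(1) fin(2) that closedB]
          less.hyps[OF fin(4) less.prems(1) fin(2)] counter_free_subset[OF less.prems(3) fin(6)] that
        by blast
      \<comment> \<open>One letter for a block together with the \<open>c\<close> that closes it.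
        Restriction to \<open>Q'\<close> identifies blocks that act alike there, so finitely many
        letters remain; they are again functions on the same type, as the induction hypothesis
        demands.\<close>
      define f where "f x = restrict (\<lambda>r. c (run x r)) Q'" for x
      define A' where "A' = f ` lists B"
      have f: "f x r = run (x @ [c]) r" if "r \<in> Q'" for x r
        using that by (simp add: f_def)
      have A'_sub: "A' \<subseteq> Q' \<rightarrow>\<^sub>E Q'"
      proof -
        have "c (run x r) \<in> Q'" if "x \<in> lists B" "r \<in> Q'" for x r
          using that runB cQ Q' by blast
        then show ?thesis
          unfolding A'_def f_def by (intro image_subsetI restrict_PiE_iff[THEN iffD2]) blast
      qed
      have finA': "finite A'"
        using A'_sub finite_PiE[of Q' "\<lambda>_. Q'"] fin(1) finite_subset by blast
      have closedA': "\<forall>g\<in>A'. g ` Q' \<subseteq> Q'"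
        using A'_sub by blast
      have lists_A': "\<exists>ws\<in>lists (lists B). w = map f ws" if "w \<in> lists A'" for w
        using that unfolding A'_def lists_image by blast
      have run_blocks: "run (map f ws) r = run (concat (map (\<lambda>x. x @ [c]) ws)) r \<and>
          run (map f ws) r \<in> Q'" if "ws \<in> lists (lists B)" "r \<in> Q'" for ws r
        using that(1)
      proof (induction ws rule: rev_induct)
        case (snoc x ws)
        then have *: "ws \<in> lists (lists B)" "x \<in> lists B"
          by simp_all
        then have IH: "run (map f ws) r = run (concat (map (\<lambda>x. x @ [c]) ws)) r"
          "run (map f ws) r \<in> Q'"
          using snoc.IH by blast+
        moreover have "run x (run (map f ws) r) \<in> Q"
          using runB *(2) IH(2) Q' by blast
        ultimately show ?case
          using f cQ by simp
      qed (use that in simp)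
      have cf': "counter_free Q' A'"
        unfolding counter_free_def
      proof (intro conjI ballI)
        fix w assume "w \<in> lists A'"
        then obtain ws where ws: "ws \<in> lists (lists B)" "w = map f ws"
          using lists_A' by blast
        let ?W = "concat (map (\<lambda>x. x @ [c]) ws)"
        have "?W \<in> lists A"
          using ws(1) fin(6) c(1) by (induction ws) auto
        then obtain n where n: "\<forall>q\<in>Q. (run ?W ^^ Suc n) q = (run ?W ^^ n) q"
          using less.prems(3) unfolding counter_free_def by blast
        \<comment> \<open>On \<open>Q'\<close>, the word \<open>w\<close> over blocks acts as the
          underlying word \<open>?W\<close> over \<open>A\<close>, whose exponent \<open>n\<close>
          therefore serves for \<open>w\<close>.\<close>
        have eq: "(run w ^^ k) r = (run ?W ^^ k) r \<and> (run w ^^ k) r \<in> Q'" if "r \<in> Q'" for k r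
        proof (induction k)
          case (Suc k)
          then show ?case
            using run_blocks[OF ws(1) conjunct2[OF Suc]] ws(2) by auto
        qed (use that in simp)
        have "(run w ^^ Suc n) r = (run w ^^ n) r" if "r \<in> Q'" for r
          using eq[OF that, of n] eq[OF that, of "Suc n"] n Q' that by (metis psubsetD)
        then show "\<exists>n. \<forall>q\<in>Q'. (run w ^^ Suc n) q = (run w ^^ n) q"
          by blast
      qed (use closedA' in blast)
      have pd_f: "past_definable {x \<in> lists B. f x \<in> X}" for X
      proof -
        have f_eq: "f x = g \<longleftrightarrow> (\<forall>r\<in>Q'. c (run x r) = g r)" if "g \<in> A'" for x g
        proof -
          have "f x \<in> extensional Q'" "g \<in> extensional Q'"
            using that by (auto simp: A'_def f_def)
          then show ?thesis
            by (auto simp: f_def intro: extensionalityI)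
        qed
        have "past_definable {x \<in> lists B. f x = g}" if "g \<in> A'" for g
        proof -
          have "{x \<in> lists B. f x = g} =
              lists B \<inter> (\<Inter>r\<in>Q'. {x \<in> lists B. c (run x r) = g r})"
            using f_eq[OF that] by auto
          moreover have "past_definable {x \<in> lists B. c (run x r) = g r}" if "r \<in> Q'" for r
            using pdB[of r "\<lambda>s. c s = g r"] Q' that by blast
          ultimately show ?thesis
            by (simp only:) (intro past_definable_Int past_definable_lists past_definable_INT fin(1))
        qed
        moreover have "{x \<in> lists B. f x \<in> X} = (\<Union>g\<in>A' \<inter> X. {x \<in> lists B. f x = g})"
          by (auto simp: A'_def)
        ultimately show ?thesis
          using past_definable_UN[of "A' \<inter> X" "\<lambda>g. {x \<in> lists B. f x = g}"] finA' by simp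
      qed
      \<comment> \<open>Remembers the state \<open>p0\<close> entered at the first \<open>c\<close>.
        The latch is never reset, and since words over \<open>B\<close> avoid \<open>c\<close>, the
        only prefix that can set it is \<open>w0 @ [c]\<close>.\<close>
      define First where
        "First p0 = latch (ends_in {c} \<inter> delay {x \<in> lists B. c (run x p) = p0}) {}" for p0
      have First: "past_definable (First p0)" for p0
        unfolding First_def
        by (intro past_definable.latch past_definable_Int past_definable.ends_in
            past_definable.delay past_definable_empty pdB less.prems)
      have First_iff: "blocks c w0 ws v \<in> First p0 \<longleftrightarrow> c (run w0 p) = p0"
        if "w0 \<in> lists B" for w0 ws v p0
      proof -
        let ?S = "ends_in {c} \<inter> delay {x \<in> lists B. c (run x p) = p0}"
        have S: "u \<in> ?S \<longleftrightarrow> (\<exists>x\<in>lists B. u = x @ [c] \<and> c (run x p) = p0)" for u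
          by (cases u rule: rev_cases) auto
        have "takeWhile (\<lambda>a. a \<noteq> c) (x @ c # y) = x" if "x \<in> lists B" for x y
          using that fin(5) by (subst takeWhile_append2) auto
        note cut = this
        have eq: "x = w0" if "x \<in> lists B" "blocks c w0 ws v = (x @ [c]) @ y" for x y
        proof -
          have "w0 @ c # concat (map (\<lambda>x. x @ [c]) ws) @ v = x @ c # y"
            using that(2) by (simp add: blocks_def)
          then show ?thesis
            using cut[OF that(1)] cut[OF \<open>w0 \<in> lists B\<close>] by metis
        qed
        have w0: "blocks c w0 ws v = (w0 @ [c]) @ concat (map (\<lambda>x. x @ [c]) ws) @ v"
          by (simp add: blocks_def)
        show ?thesis
        proof
          assume "blocks c w0 ws v \<in> First p0"
          then show "c (run w0 p) = p0"
            unfolding First_def latch_empty_iff S using eq by blast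
        next
          assume "c (run w0 p) = p0"
          then show "blocks c w0 ws v \<in> First p0"
            unfolding First_def latch_empty_iff S using w0 that by blast
        qed
      qed
      define is_mid where "is_mid p0 s K' \<longleftrightarrow> past_definable K' \<and>
          (\<forall>w0\<in>lists B. \<forall>ws\<in>lists (lists B). \<forall>v\<in>lists B.
            blocks c w0 ws v \<in> K' \<longleftrightarrow> map f ws \<in> {w \<in> lists A'. run w p0 = s})" for p0 s K'
      \<comment> \<open>The outer hypothesis for \<open>Q'\<close> and \<open>A'\<close>,
        transferred to words over \<open>A\<close>: the closed blocks lead from \<open>p0\<close>,
        the state after the first \<open>c\<close>, to \<open>s\<close>, the state after the last
        one.\<close>
      have "\<exists>K'. is_mid p0 s K'" if "p0 \<in> Q'" "s \<in> Q'" for p0 s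
        unfolding is_mid_def
        by (rule past_definable_blocks[OF fin(5) pd_f outer.hyps[OF fin(3,1) finA' cf' that]])
      then obtain Mid where "\<And>p0 s. p0 \<in> Q' \<Longrightarrow> s \<in> Q' \<Longrightarrow> is_mid p0 s (Mid p0 s)"
        by metis
      then have Mid: "past_definable (Mid p0 s)"
        "\<And>w0 ws v. w0 \<in> lists B \<Longrightarrow> ws \<in> lists (lists B) \<Longrightarrow> v \<in> lists B \<Longrightarrow>
          blocks c w0 ws v \<in> Mid p0 s \<longleftrightarrow> map f ws \<in> {w \<in> lists A'. run w p0 = s}"
        if "p0 \<in> Q'" "s \<in> Q'" for p0 s
        using that unfolding is_mid_def by auto
      define is_last where "is_last s K' \<longleftrightarrow> past_definable K' \<and>
          (\<forall>u v. c \<notin> set v \<longrightarrow> (u @ c # v \<in> K' \<longleftrightarrow> v \<in> {x \<in> lists B. run x s = q}))" for s K'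
      \<comment> \<open>What follows the last \<open>c\<close> uses only letters of
        \<open>B\<close>; the inner hypothesis covers it, restarted at that
        \<open>c\<close>.\<close>
      have "\<exists>K'. is_last s K'" if "s \<in> Q'" for s
        unfolding is_last_def using past_definable_restart[OF pdB[of s "\<lambda>r. r = q"], of c] Q' that
        by auto
      then obtain Last where "\<And>s. s \<in> Q' \<Longrightarrow> is_last s (Last s)"
        by metis
      then have Last: "past_definable (Last s)"
        "\<And>u v. c \<notin> set v \<Longrightarrow> u @ c # v \<in> Last s \<longleftrightarrow> v \<in> {x \<in> lists B. run x s = q}"
        if "s \<in> Q'" for s
        using that unfolding is_last_def by auto
      \<comment> \<open>The states after the first and after the last \<open>c\<close> are guessed;
        both range over the finite set \<open>Q'\<close>.\<close>
      define L where "L = (\<Union>p0\<in>Q'. \<Union>s\<in>Q'. First p0 \<inter> Mid p0 s \<inter> Last s)"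
      have L: "past_definable L"
        unfolding L_def using First Mid(1) Last(1) fin(1)
        by (intro past_definable_UN past_definable_Int) auto
      have L_iff: "blocks c w0 ws v \<in> L \<longleftrightarrow> run (blocks c w0 ws v) p = q"
        if "w0 \<in> lists B" "ws \<in> lists (lists B)" "v \<in> lists B" for w0 ws v
      proof -
        let ?p = "c (run w0 p)"
        let ?s = "run (map f ws) ?p"
        have p: "?p \<in> Q'"
          using cQ runB that(1) less.prems(4) by blast
        have s: "?s \<in> Q'" "?s = run (concat (map (\<lambda>x. x @ [c]) ws)) ?p"
          using run_blocks[OF that(2) p] by auto
        obtain u where "blocks c w0 ws v = u @ c # v"
          using blocks_last[of c w0 ws] by auto
        moreover have "c \<notin> set v"
          using that(3) fin(5) by auto
        ultimately have last: "blocks c w0 ws v \<in> Last s' \<longleftrightarrow> run v s' = q" if "s' \<in> Q'" for s'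
          using Last(2)[OF that] \<open>v \<in> lists B\<close> by simp
        have "map f ws \<in> lists A'"
          using that(2) by (auto simp: A'_def)
        then have "blocks c w0 ws v \<in> L \<longleftrightarrow> run v ?s = q"
          using p s(1) First_iff[OF that(1)] Mid(2)[OF _ _ that] last by (auto simp: L_def)
        also have "run v ?s = run (blocks c w0 ws v) p"
          by (simp add: blocks_def s(2))
        finally show ?thesis .
      qed
      have "{w \<in> lists A. run w p = q} =
          {x \<in> lists B. run x p = q} \<union> (lists A \<inter> seen c \<inter> L)" (is "?l = ?r")
      proof (intro set_eqI)
        fix w
        show "w \<in> ?l \<longleftrightarrow> w \<in> ?r"
        proof (cases "w \<in> lists A \<and> c \<in> set w")
          case True
          then obtain w0 ws v where *: "w0 \<in> lists B" "ws \<in> lists (lists B)" "v \<in> lists B"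
            "w = blocks c w0 ws v"
            unfolding B_def using blocks_exist by metis
          have "w \<notin> lists B"
            using True fin(5) by auto
          then show ?thesis
            using True L_iff[OF *(1-3)] *(4) by simp
        next
          case False
          then show ?thesis
            by (auto simp: B_def seen_def)
        qed
      qed
      then show ?thesis
        by (simp only:) (intro past_definable.Un pdB[OF less.prems(4)] past_definable_Int L
            past_definable_lists past_definable_seen)
    qed
  qed
qed

section \<open>Star-free languages and their quotients\<close>

abbreviation conc :: "'a list set \<Rightarrow> 'a list set \<Rightarrow> 'a list set" where
  "conc L L' \<equiv> {u @ v | u v. u \<in> L \<and> v \<in> L'}"

lemma star_free_subset: "star_free \<Sigma> L \<Longrightarrow> L \<subseteq> lists \<Sigma>"
proof -
  have "set_sf_regexp r \<subseteq> \<Sigma> \<Longrightarrow> sf_lang \<Sigma> r \<subseteq> lists \<Sigma>" for r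
    by (induction r) (auto, (blast dest: in_listsD)+)
  then show "star_free \<Sigma> L \<Longrightarrow> L \<subseteq> lists \<Sigma>"
    by (auto simp: star_free_def)
qed

lemma star_free_empty: "star_free \<Sigma> {}"
  unfolding star_free_def by (rule exI[of _ Empty]) simp

lemma star_free_letter: "a \<in> \<Sigma> \<Longrightarrow> star_free \<Sigma> {[a]}"
  unfolding star_free_def by (rule exI[of _ "Letter a"]) simp

lemma star_free_Un: "star_free \<Sigma> L \<Longrightarrow> star_free \<Sigma> L' \<Longrightarrow> star_free \<Sigma> (L \<union> L')"
  unfolding star_free_def by (elim exE, rule_tac x = "Union r ra" in exI) simp

lemma star_free_conc: "star_free \<Sigma> L \<Longrightarrow> star_free \<Sigma> L' \<Longrightarrow> star_free \<Sigma> (conc L L')"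
  unfolding star_free_def by (elim exE, rule_tac x = "Concat r ra" in exI) simp

lemma star_free_Compl: "star_free \<Sigma> L \<Longrightarrow> star_free \<Sigma> (lists \<Sigma> - L)"
  unfolding star_free_def by (elim exE, rule_tac x = "Compl r" in exI) simp

lemma star_free_lists: "star_free \<Sigma> (lists \<Sigma>)"
  using star_free_Compl[OF star_free_empty] by simp

lemma star_free_Int:
  assumes "star_free \<Sigma> L" "star_free \<Sigma> L'"
  shows "star_free \<Sigma> (L \<inter> L')"
proof -
  have "L \<inter> L' = lists \<Sigma> - ((lists \<Sigma> - L) \<union> (lists \<Sigma> - L'))"
    using assms[THEN star_free_subset] by blast
  then show ?thesis
    using assms by (simp only: star_free_Compl star_free_Un)
qed

lemma star_free_Diff:
  assumes "star_free \<Sigma> L" "star_free \<Sigma> L'"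
  shows "star_free \<Sigma> (L - L')"
proof -
  have "L - L' = L \<inter> (lists \<Sigma> - L')"
    using assms[THEN star_free_subset] by blast
  then show ?thesis
    using assms by (simp only: star_free_Compl star_free_Int)
qed

lemma star_free_letters:
  assumes "finite X" "X \<subseteq> \<Sigma>"
  shows "star_free \<Sigma> ((\<lambda>a. [a]) ` X)"
  using assms
proof (induction X rule: finite_induct)
  case (insert a X)
  then show ?case
    using star_free_Un[OF star_free_letter[of a \<Sigma>], of "(\<lambda>a. [a]) ` X"] by simp
qed (simp add: star_free_empty)

text \<open>The empty word is the only word that does not begin with a letter; for finite
  \<open>\<Sigma>\<close> the one-letter words form a finite union.\<close>

lemma star_free_Nil:
  assumes "finite \<Sigma>"
  shows "star_free \<Sigma> {[]}"
proof -
  have "{[]} = lists \<Sigma> - conc ((\<lambda>a. [a]) ` \<Sigma>) (lists \<Sigma>)" (is "_ = ?R")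
  proof (intro set_eqI iffI)
    fix w assume w: "w \<in> ?R"
    have False if "w = a # v" for a v
    proof -
      have "w = [a] @ v" "[a] \<in> (\<lambda>a. [a]) ` \<Sigma>" "v \<in> lists \<Sigma>"
        using w that by auto
      then show False
        using w by blast
    qed
    then show "w \<in> {[]}"
      by (cases w) auto
  qed auto
  moreover have "star_free \<Sigma> ?R"
    using assms by (intro star_free_Compl star_free_conc star_free_lists star_free_letters) auto
  ultimately show ?thesis
    by simp
qed

section \<open>Finite unions of products of star-free languages\<close>

inductive star_free_rel :: "'a set \<Rightarrow> ('a list \<times> 'a list) set \<Rightarrow> bool" for \<Sigma> where
  empty: "star_free_rel \<Sigma> {}"
| step: "star_free_rel \<Sigma> R \<Longrightarrow> star_free \<Sigma> K \<Longrightarrow> star_free \<Sigma> C \<Longrightarrow> star_free_rel \<Sigma> (K \<times> C \<union> R)"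

lemma star_free_rel_product: "star_free \<Sigma> K \<Longrightarrow> star_free \<Sigma> C \<Longrightarrow> star_free_rel \<Sigma> (K \<times> C)"
  using star_free_rel.step[OF star_free_rel.empty] by force

lemma star_free_rel_Un:
  assumes "star_free_rel \<Sigma> R" "star_free_rel \<Sigma> R'"
  shows "star_free_rel \<Sigma> (R \<union> R')"
  using assms(1)
  by (induction rule: star_free_rel.induct) (auto simp: Un_assoc assms(2) intro: star_free_rel.step)

lemma star_free_rel_Int_product:
  assumes "star_free_rel \<Sigma> R" "star_free \<Sigma> K'" "star_free \<Sigma> C'"
  shows "star_free_rel \<Sigma> ((K' \<times> C') \<inter> R)"
  using assms(1)
proof (induction rule: star_free_rel.induct)
  case (step R K C)
  have "(K' \<times> C') \<inter> (K \<times> C \<union> R) = (K' \<inter> K) \<times> (C' \<inter> C) \<union> (K' \<times> C') \<inter> R"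
    by blast
  then show ?case
    using step assms by (simp only: star_free_rel.step star_free_Int)
qed (simp add: star_free_rel.empty)

lemma star_free_rel_Int:
  assumes "star_free_rel \<Sigma> R" "star_free_rel \<Sigma> R'"
  shows "star_free_rel \<Sigma> (R \<inter> R')"
  using assms(1)
proof (induction rule: star_free_rel.induct)
  case (step R K C)
  then show ?case
    unfolding Int_Un_distrib2
    by (intro star_free_rel_Un star_free_rel_Int_product assms(2))
qed (simp add: star_free_rel.empty)

text \<open>A pair avoids a product through its first or its second component, and avoids a union by
  avoiding every member; this reduces complements to unions and intersections.\<close>

lemma star_free_rel_Compl:
  assumes "star_free_rel \<Sigma> R"
  shows "star_free_rel \<Sigma> (lists \<Sigma> \<times> lists \<Sigma> - R)"
  using assms
proof (induction rule: star_free_rel.induct)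
  case empty
  then show ?case
    by (simp add: star_free_rel_product star_free_lists)
next
  case (step R K C)
  have "lists \<Sigma> \<times> lists \<Sigma> - (K \<times> C \<union> R) =
      ((lists \<Sigma> - K) \<times> lists \<Sigma> \<union> lists \<Sigma> \<times> (lists \<Sigma> - C)) \<inter> (lists \<Sigma> \<times> lists \<Sigma> - R)"
    by blast
  moreover have "star_free_rel \<Sigma> \<dots>"
    using step
    by (intro star_free_rel_Int star_free_rel_Un star_free_rel_product star_free_Compl star_free_lists)
  ultimately show ?case
    by (simp only:)
qed

text \<open>Serves as existential quantification over prefixes of the second component, and yields
  one half of the splits of a concatenation.\<close>

lemma star_free_rel_extend_right:
  assumes "star_free_rel \<Sigma> R" "star_free \<Sigma> L"
  shows "star_free_rel \<Sigma> {(u, v @ v') | u v v'. (u, v) \<in> R \<and> v' \<in> L}"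
  using assms(1)
proof (induction rule: star_free_rel.induct)
  case (step R K C)
  have "{(u, v @ v') | u v v'. (u, v) \<in> K \<times> C \<union> R \<and> v' \<in> L} =
      K \<times> conc C L \<union> {(u, v @ v') | u v v'. (u, v) \<in> R \<and> v' \<in> L}"
    by blast
  then show ?case
    using step assms(2) by (simp only: star_free_rel.step star_free_conc)
qed (simp add: star_free_rel.empty)

lemma star_free_rel_extend_left:
  assumes "star_free_rel \<Sigma> R" "star_free \<Sigma> L"
  shows "star_free_rel \<Sigma> {(u' @ u, v) | u' u v. u' \<in> L \<and> (u, v) \<in> R}"
  using assms(1)
proof (induction rule: star_free_rel.induct)
  case (step R K C)
  have "{(u' @ u, v) | u' u v. u' \<in> L \<and> (u, v) \<in> K \<times> C \<union> R} =
      conc L K \<times> C \<union> {(u' @ u, v) | u' u v. u' \<in> L \<and> (u, v) \<in> R}"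
    by blast
  then show ?case
    using step assms(2) by (simp only: star_free_rel.step star_free_conc)
qed (simp add: star_free_rel.empty)

lemma star_free_rel_append:
  assumes "star_free_rel \<Sigma> R"
  shows "star_free \<Sigma> {u @ v | u v. (u, v) \<in> R}"
  using assms
proof (induction rule: star_free_rel.induct)
  case (step R K C)
  have "{u @ v | u v. (u, v) \<in> K \<times> C \<union> R} = conc K C \<union> {u @ v | u v. (u, v) \<in> R}"
    by blast
  then show ?case
    using step by (simp only: star_free_Un star_free_conc)
qed (simp add: star_free_empty)

text \<open>Each section is a union of some of the finitely many second factors. For
  \<open>splits \<Sigma> L\<close> the sections are the left quotients of \<open>L\<close>, so this
  is where the quotient automaton becomes finite.\<close>

lemma finite_star_free_rel_Image:
  assumes "star_free_rel \<Sigma> R"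
  shows "finite (range (\<lambda>u. R `` {u}))"
  using assms
proof (induction rule: star_free_rel.induct)
  case (step R K C)
  have "(K \<times> C \<union> R) `` {u} = (if u \<in> K then C else {}) \<union> R `` {u}" for u
    by auto
  then have "range (\<lambda>u. (K \<times> C \<union> R) `` {u}) \<subseteq>
      range (\<lambda>u. R `` {u}) \<union> (\<union>) C ` range (\<lambda>u. R `` {u})"
    by auto
  then show ?case
    using step by (meson finite_UnI finite_imageI finite_subset)
qed simp

section \<open>Factorisations of the words of a star-free language\<close>

definition splits :: "'a set \<Rightarrow> 'a list set \<Rightarrow> ('a list \<times> 'a list) set" where
  "splits \<Sigma> L = {(u, v). u \<in> lists \<Sigma> \<and> v \<in> lists \<Sigma> \<and> u @ v \<in> L}"

text \<open>Two factorisations of one word are comparable: the cut between \<open>u\<close> and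
  \<open>v\<close> falls into the factor from \<open>L\<close> or into the factor from
  \<open>L'\<close>.\<close>

lemma splits_conc:
  assumes "L \<subseteq> lists \<Sigma>" "L' \<subseteq> lists \<Sigma>"
  shows "splits \<Sigma> (conc L L') =
    {(u, v @ v') | u v v'. (u, v) \<in> splits \<Sigma> L \<and> v' \<in> L'} \<union>
    {(u' @ u, v) | u' u v. u' \<in> L \<and> (u, v) \<in> splits \<Sigma> L'}" (is "?l = ?r1 \<union> ?r2")
proof (intro set_eqI iffI)
  fix p assume "p \<in> ?l"
  then obtain u v x y where *: "p = (u, v)" "u \<in> lists \<Sigma>" "v \<in> lists \<Sigma>" "u @ v = x @ y"
    "x \<in> L" "y \<in> L'"
    by (auto simp: splits_def)
  then consider us where "u @ us = x" "v = us @ y" | us where "u = x @ us" "us @ v = y"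
    by (auto simp: append_eq_append_conv2)
  then show "p \<in> ?r1 \<union> ?r2"
  proof cases
    case 1
    then have "(u, us) \<in> splits \<Sigma> L"
      using * by (auto simp: splits_def)
    then show ?thesis
      using 1 * by blast
  next
    case 2
    then have "(us, v) \<in> splits \<Sigma> L'"
      using * by (auto simp: splits_def)
    then show ?thesis
      using 2 * by blast
  qed
next
  fix p assume "p \<in> ?r1 \<union> ?r2"
  then consider u v v' where "p = (u, v @ v')" "(u, v) \<in> splits \<Sigma> L" "v' \<in> L'"
    | u' u v where "p = (u' @ u, v)" "u' \<in> L" "(u, v) \<in> splits \<Sigma> L'"
    by blast
  then show "p \<in> ?l"
  proof cases
    case 1
    then have "(u @ v) @ v' \<in> conc L L'" "v' \<in> lists \<Sigma>"
      using assms(2) unfolding splits_def by blast+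
    then show ?thesis
      using 1 by (simp add: splits_def)
  next
    case 2
    then have "u' @ (u @ v) \<in> conc L L'" "u' \<in> lists \<Sigma>"
      using assms(1) unfolding splits_def by blast+
    then show ?thesis
      using 2 by (simp add: splits_def)
  qed
qed

lemma star_free_rel_splits:
  assumes "finite \<Sigma>" "star_free \<Sigma> L"
  shows "star_free_rel \<Sigma> (splits \<Sigma> L)"
proof -
  have "set_sf_regexp r \<subseteq> \<Sigma> \<Longrightarrow> star_free_rel \<Sigma> (splits \<Sigma> (sf_lang \<Sigma> r))" for r
  proof (induction r)
    case Empty
    then show ?case
      by (simp add: splits_def star_free_rel.empty)
  next
    case (Letter c)
    then have "splits \<Sigma> (sf_lang \<Sigma> (Letter c)) = {[]} \<times> {[c]} \<union> {[c]} \<times> {[]}"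
      by (auto simp: splits_def append_eq_Cons_conv)
    moreover have "star_free_rel \<Sigma> \<dots>"
      using Letter assms(1)
      by (intro star_free_rel_Un star_free_rel_product star_free_Nil star_free_letter) auto
    ultimately show ?case
      by (simp only:)
  next
    case (Union r s)
    have "splits \<Sigma> (sf_lang \<Sigma> (Union r s)) =
        splits \<Sigma> (sf_lang \<Sigma> r) \<union> splits \<Sigma> (sf_lang \<Sigma> s)"
      by (auto simp: splits_def)
    then show ?case
      using Union by (simp add: star_free_rel_Un)
  next
    case (Concat r s)
    have sf: "star_free \<Sigma> (sf_lang \<Sigma> r)" "star_free \<Sigma> (sf_lang \<Sigma> s)"
      using Concat.prems by (auto simp: star_free_def)
    then show ?case
      using Concat splits_conc[OF sf[THEN star_free_subset]]
      by (simp add: star_free_rel_Un star_free_rel_extend_left star_free_rel_extend_right)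
  next
    case (Compl r)
    have "splits \<Sigma> (sf_lang \<Sigma> (Compl r)) = lists \<Sigma> \<times> lists \<Sigma> - splits \<Sigma> (sf_lang \<Sigma> r)"
      by (auto simp: splits_def)
    then show ?case
      using Compl by (simp add: star_free_rel_Compl)
  qed
  then show ?thesis
    using assms(2) by (auto simp: star_free_def)
qed

text \<open>Replaces the recursion by quantifiers over factorisations. A prefix in both
  \<open>S\<close> and \<open>R\<close> leaves the flip-flop set, so only \<open>R - S\<close>
  counts as a reset, and \<open>u\<close> may be any setting prefix with no such reset after it, not
  just the latest one.\<close>

lemma latch_iff:
  "w \<in> latch S R \<longleftrightarrow> (\<exists>u v. w = u @ v \<and> u \<in> S \<and> u \<noteq> [] \<and>
     (\<forall>x y. v = x @ y \<and> x \<noteq> [] \<longrightarrow> u @ x \<notin> R - S))" (is "_ \<longleftrightarrow> ?P w")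
proof (induction w rule: rev_induct)
  case (snoc a w)
  have "?P (w @ [a]) \<longleftrightarrow> w @ [a] \<in> S \<or> w @ [a] \<notin> R \<and> ?P w"
  proof
    assume "?P (w @ [a])"
    then obtain u v where *: "w @ [a] = u @ v" "u \<in> S" "u \<noteq> []"
      "\<And>x y. v = x @ y \<Longrightarrow> x \<noteq> [] \<Longrightarrow> u @ x \<notin> R - S"
      by blast
    show "w @ [a] \<in> S \<or> w @ [a] \<notin> R \<and> ?P w"
    proof (cases v rule: rev_cases)
      case Nil
      then show ?thesis
        using * by simp
    next
      case (snoc v' b)
      then have "w = u @ v'"
        using *(1) by simp
      moreover have "w @ [a] \<notin> R - S"
        using *(1) *(4)[of v "[]"] snoc by simp
      moreover have "u @ x \<notin> R - S" if "v' = x @ y" "x \<noteq> []" for x y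
        using *(4)[of x "y @ [b]"] that snoc by simp
      ultimately show ?thesis
        using *(2,3) by blast
    qed
  next
    assume "w @ [a] \<in> S \<or> w @ [a] \<notin> R \<and> ?P w"
    then consider "w @ [a] \<in> S" | "w @ [a] \<notin> R" "?P w"
      by blast
    then show "?P (w @ [a])"
    proof cases
      case 1
      then show ?thesis
        by (intro exI[of _ "w @ [a]"] exI[of _ "[]"]) simp
    next
      case 2
      then obtain u v where *: "w = u @ v" "u \<in> S" "u \<noteq> []"
        "\<And>x y. v = x @ y \<Longrightarrow> x \<noteq> [] \<Longrightarrow> u @ x \<notin> R - S"
        by blast
      have "u @ x \<notin> R - S" if "v @ [a] = x @ y" "x \<noteq> []" for x y
      proof (cases y rule: rev_cases)
        case Nil
        then show ?thesis
          using that 2(1) *(1) by (metis Diff_iff append.right_neutral append_assoc)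
      next
        case (snoc y' b)
        then show ?thesis
          using that *(4)[of x y'] by simp
      qed
      then show ?thesis
        using *(1-3) by (intro exI[of _ u] exI[of _ "v @ [a]"]) simp
    qed
  qed
  then show ?case
    using snoc by (simp add: snoc_latch)
qed simp

lemma star_free_latch:
  assumes "finite \<Sigma>" "star_free \<Sigma> S" "star_free \<Sigma> R"
  shows "star_free \<Sigma> (latch S R \<inter> lists \<Sigma>)"
proof -
  \<comment> \<open>In \<open>T\<close> the second component is non-empty and ends at a harmful
    reset. Appending an arbitrary \<open>y\<close> says that the second factor has such a prefix,
    and the complement in \<open>U\<close> says that it has none.\<close>
  define T where "T = lists \<Sigma> \<times> (lists \<Sigma> - {[]}) \<inter> splits \<Sigma> (R - S)"
  define U where "U = (S - {[]}) \<times> lists \<Sigma> \<inter>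
    (lists \<Sigma> \<times> lists \<Sigma> - {(u, x @ y) | u x y. (u, x) \<in> T \<and> y \<in> lists \<Sigma>})"
  have "star_free_rel \<Sigma> U"
    unfolding U_def T_def using assms
    by (intro star_free_rel_Int star_free_rel_product star_free_Diff star_free_lists star_free_Nil
        star_free_rel_Compl star_free_rel_extend_right star_free_rel_splits)
  then have "star_free \<Sigma> {u @ v | u v. (u, v) \<in> U}"
    by (rule star_free_rel_append)
  moreover have "latch S R \<inter> lists \<Sigma> = {u @ v | u v. (u, v) \<in> U}"
  proof -
    have T: "(u, v) \<in> {(u, x @ y) | u x y. (u, x) \<in> T \<and> y \<in> lists \<Sigma>} \<longleftrightarrow>
        (\<exists>x y. v = x @ y \<and> x \<noteq> [] \<and> u @ x \<in> R - S)" if "u \<in> lists \<Sigma>" "v \<in> lists \<Sigma>" for u v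
      using that unfolding T_def splits_def by fastforce
    have U: "(u, v) \<in> U \<longleftrightarrow> u \<in> S \<and> u \<noteq> [] \<and> (\<forall>x y. v = x @ y \<and> x \<noteq> [] \<longrightarrow> u @ x \<notin> R - S)"
      if "u \<in> lists \<Sigma>" "v \<in> lists \<Sigma>" for u v
      using T[OF that] that unfolding U_def by blast
    have U_lists: "u \<in> lists \<Sigma> \<and> v \<in> lists \<Sigma>" if "(u, v) \<in> U" for u v
      using that unfolding U_def by blast
    show ?thesis
    proof (intro set_eqI iffI)
      fix w assume "w \<in> latch S R \<inter> lists \<Sigma>"
      then obtain u v where "w = u @ v" "u \<in> S" "u \<noteq> []" "w \<in> lists \<Sigma>"
        "\<forall>x y. v = x @ y \<and> x \<noteq> [] \<longrightarrow> u @ x \<notin> R - S"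
        unfolding Int_iff latch_iff by blast
      moreover from this have "u \<in> lists \<Sigma>" "v \<in> lists \<Sigma>"
        by auto
      ultimately have "(u, v) \<in> U"
        using U by blast
      then show "w \<in> {u @ v | u v. (u, v) \<in> U}"
        using \<open>w = u @ v\<close> by blast
    next
      fix w assume "w \<in> {u @ v | u v. (u, v) \<in> U}"
      then obtain u v where w: "w = u @ v" "(u, v) \<in> U"
        by blast
      then have uv: "u \<in> lists \<Sigma>" "v \<in> lists \<Sigma>"
        using U_lists by blast+
      then have "w \<in> latch S R"
        using w U[OF uv] unfolding latch_iff by blast
      then show "w \<in> latch S R \<inter> lists \<Sigma>"
        using w(1) uv by simp
    qed
  qed
  ultimately show ?thesis
    by simp
qed

theorem past_definable_star_free:
  assumes "finite \<Sigma>" "past_definable L"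
  shows "star_free \<Sigma> (L \<inter> lists \<Sigma>)"
  using assms(2)
proof (induction rule: past_definable.induct)
  case (ends_in X)
  have "ends_in X \<inter> lists \<Sigma> = conc (lists \<Sigma>) ((\<lambda>a. [a]) ` (X \<inter> \<Sigma>))"
    by (fastforce simp: ends_in_def)
  then show ?case
    using star_free_conc[OF star_free_lists star_free_letters, of "X \<inter> \<Sigma>" \<Sigma>] assms(1) by simp
next
  case (Compl L)
  have "- L \<inter> lists \<Sigma> = lists \<Sigma> - (L \<inter> lists \<Sigma>)"
    by blast
  then show ?case
    using Compl.IH by (simp only: star_free_Compl)
next
  case (Un L L')
  then show ?case
    by (simp add: Int_Un_distrib2 star_free_Un)
next
  case (delay L)
  have "delay L \<inter> lists \<Sigma> = conc (L \<inter> lists \<Sigma>) ((\<lambda>a. [a]) ` \<Sigma>)"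
    by (fastforce simp: delay_def)
  then show ?case
    using star_free_conc[OF delay.IH star_free_letters, of \<Sigma>] assms(1) by simp
next
  case (latch S R)
  \<comment> \<open>Membership in a latch depends on prefixes of \<open>w\<close> only, and these
    are words over \<open>\<Sigma>\<close> too.\<close>
  have "w \<in> latch S R \<longleftrightarrow> w \<in> latch (S \<inter> lists \<Sigma>) (R \<inter> lists \<Sigma>)" if "w \<in> lists \<Sigma>" for w
    using that
  proof (induction w rule: rev_induct)
    case (snoc a w)
    then have "w \<in> lists \<Sigma>"
      by simp
    then show ?case
      using snoc by (simp only: snoc_latch) blast
  qed simp
  then have "latch S R \<inter> lists \<Sigma> = latch (S \<inter> lists \<Sigma>) (R \<inter> lists \<Sigma>) \<inter> lists \<Sigma>"
    by blast
  then show ?case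
    using star_free_latch[OF assms(1) latch.IH] by simp
qed

section \<open>The counter-free automaton of quotients\<close>

abbreviation word_power :: "'a list \<Rightarrow> nat \<Rightarrow> 'a list" where
  "word_power x n \<equiv> concat (replicate n x)"

lemma word_power_in_lists: "x \<in> lists \<Sigma> \<Longrightarrow> word_power x n \<in> lists \<Sigma>"
  by (induction n) auto

lemma word_power_commutes: "word_power x n @ x = x @ word_power x n"
  by (induction n) auto

lemma word_power_split:
  assumes "u @ word_power x n @ v = y @ z"
  obtains u' where "u = y @ u'" "z = u' @ word_power x n @ v"
  | v' where "y = u @ word_power x n @ v'" "v = v' @ z"
  | i j x' x'' where "i + 1 + j = n" "x = x' @ x''" "y = u @ word_power x i @ x'"
      "z = x'' @ word_power x j @ v"
proof -
  have "(\<exists>u'. u = y @ u' \<and> z = u' @ word_power x n @ v) \<or>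
      (\<exists>v'. y = u @ word_power x n @ v' \<and> v = v' @ z) \<or>
      (\<exists>i j x' x''. i + 1 + j = n \<and> x = x' @ x'' \<and> y = u @ word_power x i @ x' \<and>
        z = x'' @ word_power x j @ v)"
    using assms
  proof (induction n arbitrary: u)
    case 0
    then show ?case
      by (auto simp: append_eq_append_conv2)
  next
    case (Suc n)
    then have "(u @ x) @ word_power x n @ v = y @ z"
      by simp
    from Suc.IH[OF this] consider u' where "u @ x = y @ u'" "z = u' @ word_power x n @ v"
      | v' where "y = (u @ x) @ word_power x n @ v'" "v = v' @ z"
      | i j x' x'' where "i + 1 + j = n" "x = x' @ x''" "y = (u @ x) @ word_power x i @ x'"
        "z = x'' @ word_power x j @ v"
      by blast
    then show ?case
    proof cases
      case 1
      from 1(1) consider us where "u @ us = y" "x = us @ u'" | us where "u = y @ us" "us @ x = u'"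
        unfolding append_eq_append_conv2 by blast
      then show ?thesis
      proof cases
        case 1
        then show ?thesis
          using \<open>z = u' @ word_power x n @ v\<close>
          by (intro disjI2 exI[of _ 0] exI[of _ n] exI[of _ us] exI[of _ u']) simp
      next
        case 2
        then show ?thesis
          using \<open>z = u' @ word_power x n @ v\<close> by auto
      qed
    next
      case 2
      then show ?thesis
        by simp
    next
      case 3
      then show ?thesis
        by (intro disjI2 exI[of _ "Suc i"] exI[of _ j] exI[of _ x'] exI[of _ x'']) simp
    qed
  qed
  then show ?thesis
    using that by blast
qed

text \<open>Aperiodicity of the syntactic monoid, with a threshold for the exponents. One
  implication suffices, as \<open>k\<close> and \<open>l\<close> may be exchanged.\<close>

definition aperiodic_at :: "'a set \<Rightarrow> 'a list set \<Rightarrow> nat \<Rightarrow> bool" where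
  "aperiodic_at \<Sigma> L n \<longleftrightarrow> (\<forall>u\<in>lists \<Sigma>. \<forall>x\<in>lists \<Sigma>. \<forall>v\<in>lists \<Sigma>. \<forall>k\<ge>n. \<forall>l\<ge>n.
     u @ word_power x k @ v \<in> L \<longrightarrow> u @ word_power x l @ v \<in> L)"

lemma aperiodic_atI:
  assumes "\<And>u x v k l. u \<in> lists \<Sigma> \<Longrightarrow> x \<in> lists \<Sigma> \<Longrightarrow> v \<in> lists \<Sigma> \<Longrightarrow> n \<le> k \<Longrightarrow> n \<le> l \<Longrightarrow>
    u @ word_power x k @ v \<in> L \<Longrightarrow> u @ word_power x l @ v \<in> L"
  shows "aperiodic_at \<Sigma> L n"
  unfolding aperiodic_at_def using assms by (intro ballI allI impI)

lemma aperiodic_atD: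
  "aperiodic_at \<Sigma> L n \<Longrightarrow> u @ word_power x k @ v \<in> L \<Longrightarrow> u \<in> lists \<Sigma> \<Longrightarrow> x \<in> lists \<Sigma> \<Longrightarrow>
    v \<in> lists \<Sigma> \<Longrightarrow> n \<le> k \<Longrightarrow> n \<le> l \<Longrightarrow> u @ word_power x l @ v \<in> L"
  unfolding aperiodic_at_def by blast

text \<open>The critical case is a cut inside a copy of \<open>x\<close>, with \<open>i\<close>
  copies before it and \<open>j\<close> after it. The summand \<open>1\<close> in the threshold pays
  for the copy that is cut: the rest forces \<open>m \<le> i\<close> or
  \<open>n \<le> j\<close>.\<close>

lemma aperiodic_at_conc:
  assumes L: "aperiodic_at \<Sigma> L m" and L': "aperiodic_at \<Sigma> L' n"
  shows "aperiodic_at \<Sigma> (conc L L') (m + n + 1)"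
proof (rule aperiodic_atI)
  fix u x v :: "'a list" and k l
  assume lists: "u \<in> lists \<Sigma>" "x \<in> lists \<Sigma>" "v \<in> lists \<Sigma>"
    and kl: "m + n + 1 \<le> k" "m + n + 1 \<le> l" and "u @ word_power x k @ v \<in> conc L L'"
  then obtain y z where yz: "u @ word_power x k @ v = y @ z" "y \<in> L" "z \<in> L'"
    by blast
  from yz(1) show "u @ word_power x l @ v \<in> conc L L'"
  proof (cases rule: word_power_split)
    case (1 u')
    have "u' @ word_power x l @ v \<in> L'"
      using aperiodic_atD[OF L', of u' k x v l] 1 lists kl yz(3) by simp
    then have "y @ (u' @ word_power x l @ v) \<in> conc L L'"
      using yz(2) by blast
    then show ?thesis
      using 1(1) by simp
  next
    case (2 v')
    have "u @ word_power x l @ v' \<in> L"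
      using aperiodic_atD[OF L, of u k x v' l] 2 lists kl yz(2) by simp
    then have "(u @ word_power x l @ v') @ z \<in> conc L L'"
      using yz(3) by blast
    then show ?thesis
      using 2(2) by simp
  next
    case (3 i j x' x'')
    \<comment> \<open>If both exponents reach their thresholds, \<open>m\<close> and
      \<open>l - 1 - m\<close> are taken; otherwise the one below its threshold is kept and the
      other absorbs the difference.\<close>
    have "\<exists>i' j'. i' + 1 + j' = l \<and> (i' = i \<or> m \<le> i \<and> m \<le> i') \<and> (j' = j \<or> n \<le> j \<and> n \<le> j')"
    proof (cases "m \<le> i")
      case True
      show ?thesis
      proof (cases "n \<le> j")
        case True
        moreover have "m + 1 + (l - 1 - m) = l" "n \<le> l - 1 - m"
          using kl by simp_all
        ultimately show ?thesis
          using \<open>m \<le> i\<close> by blast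
      next
        case False
        then have "(l - 1 - j) + 1 + j = l" "m \<le> l - 1 - j"
          using kl by simp_all
        then show ?thesis
          using \<open>m \<le> i\<close> by blast
      qed
    next
      case False
      then have "i + 1 + (l - 1 - i) = l" "n \<le> j" "n \<le> l - 1 - i"
        using 3(1) kl by simp_all
      then show ?thesis
        by blast
    qed
    then obtain i' j' where ij: "i' + 1 + j' = l" "i' = i \<or> m \<le> i \<and> m \<le> i'"
      "j' = j \<or> n \<le> j \<and> n \<le> j'"
      by blast
    have x: "x' \<in> lists \<Sigma>" "x'' \<in> lists \<Sigma>"
      using lists(2) 3(2) by auto
    have "u @ word_power x i' @ x' \<in> L"
      using ij(2) aperiodic_atD[OF L, of u i x x' i'] lists x 3(3) yz(2) by auto
    moreover have "x'' @ word_power x j' @ v \<in> L'"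
      using ij(3) aperiodic_atD[OF L', of x'' j x v j'] lists x 3(4) yz(3) by auto
    ultimately have "(u @ word_power x i' @ x') @ (x'' @ word_power x j' @ v) \<in> conc L L'"
      by blast
    moreover have "word_power x l = word_power x i' @ x @ word_power x j'"
      unfolding ij(1)[symmetric] by (simp add: replicate_add word_power_commutes)
    ultimately show ?thesis
      by (simp add: 3(2))
  qed
qed

lemma aperiodic_at_mono: "aperiodic_at \<Sigma> L m \<Longrightarrow> m \<le> n \<Longrightarrow> aperiodic_at \<Sigma> L n"
  unfolding aperiodic_at_def by (meson order_trans)

lemma star_free_aperiodic:
  assumes "star_free \<Sigma> L"
  shows "\<exists>n. aperiodic_at \<Sigma> L n"
proof -
  have "\<exists>n. aperiodic_at \<Sigma> (sf_lang \<Sigma> r) n" for r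
  proof (induction r)
    case Empty
    then show ?case
      by (auto simp: aperiodic_at_def)
  next
    case (Letter c)
    \<comment> \<open>A word of length one has no room for two copies of a non-empty
      \<open>x\<close>, whence the threshold \<open>2\<close>; for empty \<open>x\<close> all powers
      coincide.\<close>
    have "x = []" if "u @ word_power x k @ v = [c]" "2 \<le> k" for u x v and k :: nat
    proof -
      have "length (word_power x k) = k * length x"
        by (simp add: length_concat sum_list_replicate)
      then have "k * length x \<le> 1"
        using arg_cong[OF that(1), of length] by simp
      then have "2 * length x \<le> 1"
        using that(2) by (meson le_trans mult_le_mono1)
      then show ?thesis
        by (cases x) auto
    qed
    then have "u @ word_power x l @ v = [c]" if "u @ word_power x k @ v = [c]" "2 \<le> k" for u x v k l
      using that by fastforce
    then have "aperiodic_at \<Sigma> {[c]} 2"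
      by (intro aperiodic_atI) blast
    then show ?case
      by auto
  next
    case (Union r s)
    then obtain m n where "aperiodic_at \<Sigma> (sf_lang \<Sigma> r) m" "aperiodic_at \<Sigma> (sf_lang \<Sigma> s) n"
      by blast
    then have "aperiodic_at \<Sigma> (sf_lang \<Sigma> r) (max m n)" "aperiodic_at \<Sigma> (sf_lang \<Sigma> s) (max m n)"
      by (auto intro: aperiodic_at_mono)
    then have "aperiodic_at \<Sigma> (sf_lang \<Sigma> (Union r s)) (max m n)"
      unfolding aperiodic_at_def sf_lang.simps Un_iff by blast
    then show ?case
      by blast
  next
    case (Concat r s)
    then show ?case
      unfolding sf_lang.simps using aperiodic_at_conc by blast
  next
    case (Compl r)
    then obtain n where n: "aperiodic_at \<Sigma> (sf_lang \<Sigma> r) n"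
      by blast
    have "aperiodic_at \<Sigma> (sf_lang \<Sigma> (Compl r)) n"
    proof (rule aperiodic_atI)
      fix u x v k l
      assume *: "u \<in> lists \<Sigma>" "x \<in> lists \<Sigma>" "v \<in> lists \<Sigma>" "n \<le> k" "n \<le> l"
        and "u @ word_power x k @ v \<in> sf_lang \<Sigma> (Compl r)"
      \<comment> \<open>Contraposition: the implication for \<open>r\<close> is used with
        \<open>k\<close> and \<open>l\<close> exchanged.\<close>
      then have "u @ word_power x l @ v \<notin> sf_lang \<Sigma> r"
        using aperiodic_atD[OF n, of u l x v k] by auto
      moreover have "u @ word_power x l @ v \<in> lists \<Sigma>"
        using * word_power_in_lists[of x \<Sigma> l] by simp
      ultimately show "u @ word_power x l @ v \<in> sf_lang \<Sigma> (Compl r)"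
        by simp
    qed
    then show ?case
      by blast
  qed
  then show ?thesis
    using assms by (auto simp: star_free_def)
qed

section \<open>Left quotients as states\<close>

definition quotient :: "'a list set \<Rightarrow> 'a list \<Rightarrow> 'a list set" where
  "quotient L u = {v. u @ v \<in> L}"

text \<open>The Brzozowski derivative. As a function on languages it is itself a letter in the sense
  of \<open>run\<close>.\<close>

definition derive_by :: "'a \<Rightarrow> 'a list set \<Rightarrow> 'a list set" where
  "derive_by a L = {v. a # v \<in> L}"

lemma run_derive_by: "run (map derive_by w) (quotient L u) = quotient L (u @ w)"
proof (induction w arbitrary: u)
  case (Cons a w)
  have "derive_by a (quotient L u) = quotient L (u @ [a])"
    by (simp add: quotient_def derive_by_def)
  then show ?case
    using Cons[of "u @ [a]"] by simp
qed simp

lemma finite_quotients: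
  assumes "finite \<Sigma>" "star_free \<Sigma> L"
  shows "finite (quotient L ` lists \<Sigma>)"
proof -
  have "quotient L u = splits \<Sigma> L `` {u}" if "u \<in> lists \<Sigma>" for u
    using that star_free_subset[OF assms(2)] by (fastforce simp: quotient_def splits_def)
  then have "quotient L ` lists \<Sigma> \<subseteq> range (\<lambda>u. splits \<Sigma> L `` {u})"
    by blast
  then show ?thesis
    using finite_star_free_rel_Image[OF star_free_rel_splits[OF assms]] finite_subset by blast
qed

text \<open>Iterating \<open>run w\<close> on the quotient by \<open>u\<close> appends powers of
  \<open>x\<close> to \<open>u\<close>. Aperiodicity of \<open>L\<close> makes these quotients
  stabilise at an exponent independent of \<open>u\<close>.\<close>

lemma counter_free_quotients:
  assumes "star_free \<Sigma> L"
  shows "counter_free (quotient L ` lists \<Sigma>) (derive_by ` \<Sigma>)"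
  unfolding counter_free_def
proof (intro conjI ballI)
  fix f assume "f \<in> derive_by ` \<Sigma>"
  then obtain a where a: "a \<in> \<Sigma>" "f = derive_by a"
    by blast
  have "f (quotient L u) = quotient L (u @ [a])" for u
    using run_derive_by[of "[a]"] a by simp
  moreover have "u @ [a] \<in> lists \<Sigma>" if "u \<in> lists \<Sigma>" for u
    using a that by simp
  ultimately show "f ` quotient L ` lists \<Sigma> \<subseteq> quotient L ` lists \<Sigma>"
    by blast
next
  fix w assume "w \<in> lists (derive_by ` \<Sigma>)"
  then obtain x where x: "x \<in> lists \<Sigma>" "w = map derive_by x"
    unfolding lists_image by blast
  obtain n where n: "aperiodic_at \<Sigma> L n"
    using star_free_aperiodic[OF assms] by blast
  have pow: "(run w ^^ k) (quotient L u) = quotient L (u @ word_power x k)" for k u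
  proof (induction k)
    case (Suc k)
    then show ?case
      using x(2) word_power_commutes[of k x] by (simp add: run_derive_by)
  qed simp
  have "quotient L (u @ word_power x (Suc n)) = quotient L (u @ word_power x n)" if u: "u \<in> lists \<Sigma>" for u
  proof -
    have "u @ word_power x k @ v \<in> L \<Longrightarrow> v \<in> lists \<Sigma>" for k v
      using star_free_subset[OF assms] by auto
    then have "u @ word_power x (Suc n) @ v \<in> L \<longleftrightarrow> u @ word_power x n @ v \<in> L" for v
      using aperiodic_atD[OF n _ u x(1)] by (metis le_refl le_SucI)
    then show ?thesis
      unfolding quotient_def by simp
  qed
  then show "\<exists>n. \<forall>q\<in>quotient L ` lists \<Sigma>. (run w ^^ Suc n) q = (run w ^^ n) q"
    unfolding pow[symmetric] by blast
qed

theorem star_free_past_definable: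
  assumes "finite \<Sigma>" "star_free \<Sigma> L"
  shows "past_definable L"
proof -
  let ?Q = "quotient L ` lists \<Sigma>"
  \<comment> \<open>The initial state \<open>quotient L []\<close> is \<open>L\<close> itself, and
    the accepting states are the quotients that contain the empty word.\<close>
  let ?K = "\<Union>q\<in>{q \<in> ?Q. [] \<in> q}. {w \<in> lists (derive_by ` \<Sigma>). run w (quotient L []) = q}"
  have "past_definable ?K"
    using assms finite_quotients[OF assms]
    by (intro past_definable_UN counter_free_past_definable[of ?Q] counter_free_quotients) auto
  then have "past_definable ({w. map derive_by w \<in> ?K} \<inter> lists \<Sigma>)"
    by (intro past_definable_Int past_definable_vimage_map past_definable_lists)
  moreover have "map derive_by w \<in> ?K \<longleftrightarrow> w \<in> L" if "w \<in> lists \<Sigma>" for w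
  proof -
    have "quotient L w \<in> ?Q" "map derive_by w \<in> lists (derive_by ` \<Sigma>)"
      using that by auto
    moreover have "[] \<in> quotient L w \<longleftrightarrow> w \<in> L"
      by (simp add: quotient_def)
    ultimately show ?thesis
      unfolding UN_iff mem_Collect_eq run_derive_by by auto
  qed
  then have "{w. map derive_by w \<in> ?K} \<inter> lists \<Sigma> = L"
    using star_free_subset[OF assms(2)] by blast
  ultimately show ?thesis
    by simp
qed

section \<open>The languages of the variables of a program\<close>

text \<open>Satisfaction at time \<open>t\<close> is tied to the prefix of length \<open>t\<close>,
  time \<open>0\<close> to the empty word. All times are covered, not just the last one, because
  delay and dynamic rules refer back to earlier times.\<close>

definition realises :: "rule set \<Rightarrow> var list \<Rightarrow> sform \<Rightarrow> bool list list set \<Rightarrow> bool" where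
  "realises P xs \<phi> L \<longleftrightarrow> (\<forall>w\<in>lists (bools (length xs)). \<forall>t\<le>length w.
     sat P (map (letter_interp xs) w) t \<phi> \<longleftrightarrow> take t w \<in> L)"

lemma realisesI:
  assumes "\<And>w t. w \<in> lists (bools (length xs)) \<Longrightarrow> t \<le> length w \<Longrightarrow>
    sat P (map (letter_interp xs) w) t \<phi> \<longleftrightarrow> take t w \<in> L"
  shows "realises P xs \<phi> L"
  using assms by (simp add: realises_def)

lemma realisesD:
  "realises P xs \<phi> L \<Longrightarrow> w \<in> lists (bools (length xs)) \<Longrightarrow> t \<le> length w \<Longrightarrow>
    sat P (map (letter_interp xs) w) t \<phi> \<longleftrightarrow> take t w \<in> L"
  by (simp add: realises_def)

lemma take_pos:
  assumes "0 < t" "t \<le> length w"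
  shows "take t w = take (t - 1) w @ [w ! (t - 1)]"
  using take_Suc_conv_app_nth[of "t - 1" w] assms by simp

lemma realises_Top: "realises P xs Top UNIV"
  by (rule realisesI) simp

lemma realises_Bot: "realises P xs Bot {}"
  by (rule realisesI) simp

lemma realises_Neg: "realises P xs \<phi> L \<Longrightarrow> realises P xs (Neg \<phi>) (- L)"
  by (simp add: realises_def)

lemma realises_And:
  "realises P xs \<phi> L \<Longrightarrow> realises P xs \<psi> L' \<Longrightarrow> realises P xs (And \<phi> \<psi>) (L \<inter> L')"
  by (simp add: realises_def)

lemma realises_Or:
  "realises P xs \<phi> L \<Longrightarrow> realises P xs \<psi> L' \<Longrightarrow> realises P xs (Or \<phi> \<psi>) (L \<union> L')"
  by (simp add: realises_def)

lemma realises_static: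
  "program P \<Longrightarrow> Static p \<alpha> \<in> P \<Longrightarrow> realises P xs \<alpha> L \<Longrightarrow> realises P xs (Var p) L"
  by (simp add: realises_def sat_static)

lemma realises_delay:
  assumes "program P" "Delay p q \<in> P" "realises P xs (Var q) L"
  shows "realises P xs (Var p) (delay L)"
proof (rule realisesI)
  fix w t assume w: "w \<in> lists (bools (length xs))" "t \<le> length w"
  show "sat P (map (letter_interp xs) w) t (Var p) \<longleftrightarrow> take t w \<in> delay L"
  proof (cases "0 < t")
    case True
    then show ?thesis
      using realisesD[OF assms(3) w(1), of "t - 1"] w(2)
      by (simp add: sat_delay[OF assms(1,2)] take_pos)
  qed (simp add: sat_delay[OF assms(1,2)])
qed

lemma realises_input:
  assumes "program P" "p \<notin> defined_vars P" "distinct xs" "k < length xs" "p = xs ! k"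
  shows "realises P xs (Var p) (ends_in {\<sigma>. \<sigma> ! k})"
proof (rule realisesI)
  fix w t assume w: "w \<in> lists (bools (length xs))" "t \<le> length w"
  have "p \<in> letter_interp xs \<sigma> \<longleftrightarrow> \<sigma> ! k" for \<sigma>
    using assms(3-5) by (auto simp: letter_interp_def nth_eq_iff_index_eq)
  then show "sat P (map (letter_interp xs) w) t (Var p) \<longleftrightarrow> take t w \<in> ends_in {\<sigma>. \<sigma> ! k}"
    using w(2) by (cases "t = 0") (simp_all add: sat_input[OF assms(1,2)] take_pos)
qed

lemma realises_non_input:
  assumes "program P" "p \<notin> defined_vars P" "p \<notin> set xs"
  shows "realises P xs (Var p) {}"
proof (rule realisesI)
  fix w t assume w: "w \<in> lists (bools (length xs))" "t \<le> length w"
  have "p \<notin> letter_interp xs \<sigma>" for \<sigma>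
    using assms(3) by (auto simp: letter_interp_def)
  then show "sat P (map (letter_interp xs) w) t (Var p) \<longleftrightarrow> take t w \<in> {}"
    using w(2) by (cases "t = 0") (simp_all add: sat_input[OF assms(1,2)])
qed

lemma bools_2: "\<sigma> \<in> bools 2 \<longleftrightarrow> (\<exists>a b. \<sigma> = [a, b])"
  by (auto simp: bools_def length_Suc_conv numeral_2_eq_2)

text \<open>At each time exactly one of the two state variables holds. With this invariant, proved
  by induction on time, the clause for dynamic rules becomes the recursion of
  \<open>latch\<close>.\<close>

lemma sat_flip_flop:
  assumes P: "program P" and D: "Dynamic [p1, p2] flip_flop [s, r] \<in> P"
  shows "sat P I 0 (Var p2) \<longleftrightarrow> False"
    and "sat P I t (Var p1) \<longleftrightarrow> \<not> sat P I t (Var p2)"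
    and "sat P I (Suc t) (Var p2) \<longleftrightarrow>
      sat P I (Suc t) (Var s) \<or> \<not> sat P I (Suc t) (Var r) \<and> sat P I t (Var p2)"
proof -
  have sel: "states flip_flop = 2" "arity flip_flop = 2" "init flip_flop = 1"
    "delta flip_flop = flip_flop_delta"
    by (simp_all add: flip_flop_def)
  have two: "{1..2} = {1, 2 :: nat}" "{..<2} = {0, 1 :: nat}"
    by auto
  have zero: "sat P I 0 (Var p1)" "\<not> sat P I 0 (Var p2)"
    using sat_dynamic[OF P D, of 1 I 0] sat_dynamic[OF P D, of 2 I 0] by (simp_all add: sel)
  have suc: "sat P I (Suc t) (Var ([p1, p2] ! (i - 1))) \<longleftrightarrow>
      (\<exists>j\<in>{1, 2}. flip_flop_delta j [sat P I (Suc t) (Var s), sat P I (Suc t) (Var r)] = i \<and>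
        sat P I t (Var ([p1, p2] ! (j - 1))))" if "i \<in> {1..2}" for i t
  proof -
    define inputs where
      "inputs \<sigma> \<longleftrightarrow> (\<forall>k\<in>{..<2}. sat P I (Suc t) (Var ([s, r] ! k)) \<longleftrightarrow> \<sigma> ! k)" for \<sigma>
    \<comment> \<open>Satisfaction at \<open>Suc t\<close> determines the input letter, which
      removes the quantifier over \<open>\<sigma>\<close>.\<close>
    have "\<sigma> \<in> bools 2 \<and> inputs \<sigma> \<longleftrightarrow>
        \<sigma> = [sat P I (Suc t) (Var s), sat P I (Suc t) (Var r)]" for \<sigma>
      unfolding inputs_def by (auto simp: bools_2 two)
    moreover have "sat P I (Suc t) (Var ([p1, p2] ! (i - 1))) \<longleftrightarrow>
        (\<exists>j \<sigma>. j \<in> {1..2} \<and> \<sigma> \<in> bools 2 \<and> flip_flop_delta j \<sigma> = i \<and>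
          sat P I t (Var ([p1, p2] ! (j - 1))) \<and> inputs \<sigma>)"
      using sat_dynamic[OF P D, of i I "Suc t"] that unfolding sel inputs_def by simp
    ultimately show ?thesis
      unfolding two(1) by metis
  qed
  have suc1: "sat P I (Suc t) (Var p1) \<longleftrightarrow> \<not> sat P I (Suc t) (Var s) \<and>
      (sat P I (Suc t) (Var r) \<or> sat P I t (Var p1))"
    if "sat P I t (Var p1) \<longleftrightarrow> \<not> sat P I t (Var p2)" for t
    using suc[of 1 t] that
    by (cases "sat P I (Suc t) (Var s)"; cases "sat P I (Suc t) (Var r)") auto
  have suc2: "sat P I (Suc t) (Var p2) \<longleftrightarrow> sat P I (Suc t) (Var s) \<or>
      \<not> sat P I (Suc t) (Var r) \<and> sat P I t (Var p2)"
    if "sat P I t (Var p1) \<longleftrightarrow> \<not> sat P I t (Var p2)" for t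
    using suc[of 2 t] that
    by (cases "sat P I (Suc t) (Var s)"; cases "sat P I (Suc t) (Var r)") auto
  have neg: "sat P I t (Var p1) \<longleftrightarrow> \<not> sat P I t (Var p2)" for t
  proof (induction t)
    case (Suc t)
    then show ?case
      using suc1[OF Suc] suc2[OF Suc] by blast
  qed (use zero in simp)
  show "sat P I 0 (Var p2) \<longleftrightarrow> False" "sat P I t (Var p1) \<longleftrightarrow> \<not> sat P I t (Var p2)"
    "sat P I (Suc t) (Var p2) \<longleftrightarrow>
      sat P I (Suc t) (Var s) \<or> \<not> sat P I (Suc t) (Var r) \<and> sat P I t (Var p2)"
    using zero neg suc2[OF neg] by simp_all
qed

lemma realises_latch:
  assumes "program P" "Dynamic [p1, p2] flip_flop [s, r] \<in> P"
    and S: "realises P xs (Var s) S" and R: "realises P xs (Var r) R"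
  shows "realises P xs (Var p2) (latch S R)" and "realises P xs (Var p1) (- latch S R)"
proof -
  have "sat P (map (letter_interp xs) w) t (Var p2) \<longleftrightarrow> take t w \<in> latch S R"
    if w: "w \<in> lists (bools (length xs))" "t \<le> length w" for w t
    using w(2)
  proof (induction t)
    case (Suc t)
    have "take (Suc t) w = take t w @ [w ! t]"
      using take_pos[of "Suc t" w] Suc.prems by simp
    then show ?case
      using Suc realisesD[OF S w(1) Suc.prems] realisesD[OF R w(1) Suc.prems]
      by (simp add: sat_flip_flop(3)[OF assms(1,2)] snoc_latch)
  qed (simp add: sat_flip_flop(1)[OF assms(1,2)])
  then show "realises P xs (Var p2) (latch S R)" "realises P xs (Var p1) (- latch S R)"
    by (simp_all add: realises_def sat_flip_flop(2)[OF assms(1,2)])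
qed

lemma realises_sform:
  assumes "\<And>p. p \<in> vars_sform \<phi> \<Longrightarrow> \<exists>L. past_definable L \<and> realises P xs (Var p) L"
  shows "\<exists>L. past_definable L \<and> realises P xs \<phi> L"
  using assms
proof (induction \<phi>)
  case Top
  then show ?case
    using realises_Top past_definable_UNIV by blast
next
  case Bot
  then show ?case
    using realises_Bot past_definable_empty by blast
next
  case (Neg \<phi>)
  then show ?case
    using realises_Neg past_definable.Compl by (metis vars_sform.simps(4))
next
  case (And \<phi> \<psi>)
  then obtain L L' where "past_definable L" "realises P xs \<phi> L"
    "past_definable L'" "realises P xs \<psi> L'"
    by (metis UnCI vars_sform.simps(5))
  then show ?case
    using realises_And past_definable_Int by blast
next
  case (Or \<phi> \<psi>)
  then obtain L L' where "past_definable L" "realises P xs \<phi> L"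
    "past_definable L'" "realises P xs \<psi> L'"
    by (metis UnCI vars_sform.simps(6))
  then show ?case
    using realises_Or past_definable.Un by blast
qed simp

text \<open>The variables in a rule body have smaller rank than those in its head, so their
  languages are available by induction; dependence on earlier times is absorbed by
  \<open>delay\<close> and \<open>latch\<close>.\<close>

theorem program_past_definable:
  assumes "P \<in> KR_logic {flip_flop}" "distinct xs"
  shows "\<exists>L. past_definable L \<and> realises P xs (Var p) L"
proof (induction "var_rank P p" arbitrary: p rule: less_induct)
  case less
  have P: "program P" and ff: "\<And>ps A as. Dynamic ps A as \<in> P \<Longrightarrow> A = flip_flop"
    using assms(1) by (auto simp: KR_logic_def)
  show ?case
  proof (cases "p \<in> defined_vars P")
    case False
    show ?thesis
    proof (cases "p \<in> set xs")
      case True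
      then obtain k where "k < length xs" "p = xs ! k"
        by (metis in_set_conv_nth)
      then show ?thesis
        using realises_input[OF P False assms(2)] past_definable.ends_in by blast
    next
      case False
      then show ?thesis
        using realises_non_input[OF P \<open>p \<notin> defined_vars P\<close>] past_definable_empty by blast
    qed
  next
    case True
    then obtain \<rho> where \<rho>: "\<rho> \<in> P" "p \<in> rule_head \<rho>"
      by (auto simp: defined_vars_def)
    have IH: "\<exists>L. past_definable L \<and> realises P xs (Var q) L" if "q \<in> rule_body \<rho>" for q
    proof -
      have "(q, p) \<in> dep_graph P"
        using that \<rho> by (auto simp: dep_graph_def)
      then show ?thesis
        using less var_rank_less[OF P] by blast
    qed
    show ?thesis
    proof (cases \<rho>)
      case (Static p' \<alpha>)
      then have "Static p \<alpha> \<in> P"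
        using \<rho> by simp
      moreover have "\<exists>L. past_definable L \<and> realises P xs \<alpha> L"
        by (rule realises_sform) (use IH Static in simp)
      ultimately show ?thesis
        using realises_static[OF P] by blast
    next
      case (Delay p' q)
      then have "Delay p q \<in> P"
        using \<rho> by simp
      moreover have "\<exists>L. past_definable L \<and> realises P xs (Var q) L"
        using IH Delay by simp
      ultimately show ?thesis
        using realises_delay[OF P] past_definable.delay by blast
    next
      case (Dynamic ps A as)
      then have "A = flip_flop"
        using ff \<rho>(1) by blast
      then have "length ps = 2" "length as = 2"
        using program_Dynamic[OF P] \<rho>(1) Dynamic by (simp_all add: flip_flop_def)
      then obtain p1 p2 s r where ps: "ps = [p1, p2]" "as = [s, r]"
        by (auto simp: length_Suc_conv numeral_2_eq_2)
      then have D: "Dynamic [p1, p2] flip_flop [s, r] \<in> P"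
        using \<rho>(1) Dynamic \<open>A = flip_flop\<close> by simp
      obtain S R where SR: "past_definable S" "realises P xs (Var s) S"
        "past_definable R" "realises P xs (Var r) R"
        using IH[of s] IH[of r] Dynamic ps by auto
      have "past_definable (latch S R)" "past_definable (- latch S R)"
        using SR by (simp_all add: past_definable.latch past_definable.Compl)
      moreover have "p = p1 \<or> p = p2"
        using \<rho>(2) Dynamic ps by auto
      ultimately show ?thesis
        using realises_latch[OF P D SR(2,4)] by blast
    qed
  qed
qed

section \<open>Extending programs\<close>

lemma finite_vars:
  assumes "finite P"
  shows "finite (vars P)"
proof -
  have "finite (rule_head \<rho> \<union> rule_body \<rho>)" for \<rho>
    by (cases \<rho>) auto
  then show ?thesis
    using assms by (simp add: vars_def)
qed

lemma rule_vars_subset: "\<rho> \<in> P \<Longrightarrow> rule_head \<rho> \<subseteq> vars P \<and> rule_body \<rho> \<subseteq> vars P"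
  by (auto simp: vars_def)

lemma program_insert:
  assumes P: "program P" and \<rho>: "wf_rule \<rho>" "rule_head \<rho> \<inter> vars P = {}"
    "rule_head \<rho> \<inter> rule_body \<rho> = {}"
  shows "program (insert \<rho> P)"
proof -
  \<comment> \<open>The new head variables are placed on top, the other variables ordered by
    \<open>var_rank\<close>. The heads being fresh, no old edge touches them, and each new edge
    enters them from below.\<close>
  let ?r = "inv_image (less_than <*lex*> less_than)
    (\<lambda>v. (if v \<in> rule_head \<rho> then 1 :: nat else 0, var_rank P v))"
  have "(u, v) \<in> ?r" if uv: "(u, v) \<in> dep_graph (insert \<rho> P)" for u v
  proof (cases "(u, v) \<in> dep_graph P")
    case True
    then have "u \<in> vars P" "v \<in> vars P"
      by (auto simp: dep_graph_def vars_def)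
    then have "u \<notin> rule_head \<rho>" "v \<notin> rule_head \<rho>"
      using \<rho>(2) by auto
    then show ?thesis
      using var_rank_less[OF P True] by simp
  next
    case False
    then have "u \<in> rule_body \<rho>" "v \<in> rule_head \<rho>"
      using uv by (auto simp: dep_graph_def)
    then show ?thesis
      using \<rho>(3) by auto
  qed
  then have "dep_graph (insert \<rho> P) \<subseteq> ?r"
    by auto
  moreover have "wf ?r"
    by (intro wf_inv_image wf_lex_prod wf_less_than)
  ultimately have "nonrecursive (insert \<rho> P)"
    unfolding nonrecursive_def using wf_acyclic acyclic_subset by blast
  moreover have "definitorial (insert \<rho> P)"
    using P \<rho>(2) rule_vars_subset[of _ P] unfolding definitorial_def program_def by blast
  ultimately show ?thesis
    using P \<rho>(1) by (simp add: program_def)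
qed

lemma sat_cong_vars:
  assumes "\<And>p. p \<in> vars_sform \<phi> \<Longrightarrow> sat P I t (Var p) = sat P' I t (Var p)"
  shows "sat P I t \<phi> = sat P' I t \<phi>"
  using assms by (induction \<phi>) auto

text \<open>Induction on time and, at a fixed time, on the rank: rule bodies of static and dynamic
  rules descend in rank, whereas delays and previous states go back in time, with no bound on the
  rank.\<close>

lemma sat_insert:
  assumes P: "program P" "program (insert \<rho> P)" and \<rho>: "rule_head \<rho> \<inter> vars P = {}"
    and \<phi>: "vars_sform \<phi> \<inter> rule_head \<rho> = {}"
  shows "sat (insert \<rho> P) I t \<phi> = sat P I t \<phi>"
proof -
  have "sat (insert \<rho> P) I t (Var p) = sat P I t (Var p)" if "p \<notin> rule_head \<rho>" for t p
    using that
  proof (induction t arbitrary: p rule: less_induct)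
    case (less t)
    note outer = less.IH
    from less.prems show ?case
    proof (induction "var_rank P p" arbitrary: p rule: less_induct)
      case (less p)
      show ?case
      proof (cases "p \<in> defined_vars P")
        case False
        then have "p \<notin> defined_vars (insert \<rho> P)"
          using less.prems by (simp add: defined_vars_def)
        then show ?thesis
          using False P by (simp add: sat_input)
      next
        case True
        then obtain \<tau> where \<tau>: "\<tau> \<in> P" "p \<in> rule_head \<tau>"
          by (auto simp: defined_vars_def)
        have head: "q \<notin> rule_head \<rho>" if "q \<in> rule_head \<tau> \<union> rule_body \<tau>" for q
          using that rule_vars_subset[OF \<tau>(1)] \<rho> by blast
        have body: "sat (insert \<rho> P) I t (Var q) = sat P I t (Var q)" if "q \<in> rule_body \<tau>" for q
        proof -
          have "(q, p) \<in> dep_graph P"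
            using that \<tau> by (auto simp: dep_graph_def)
          then show ?thesis
            using less.hyps var_rank_less[OF P(1)] head that by blast
        qed
        show ?thesis
        proof (cases \<tau>)
          case (Static p' \<alpha>)
          then have *: "Static p \<alpha> \<in> P"
            using \<tau> by simp
          have "sat (insert \<rho> P) I t \<alpha> = sat P I t \<alpha>"
            by (rule sat_cong_vars) (use body Static in simp)
          then show ?thesis
            using sat_static[OF P(1) *] sat_static[OF P(2), of p \<alpha>] * by simp
        next
          case (Delay p' q)
          then have *: "Delay p q \<in> P" "q \<notin> rule_head \<rho>"
            using \<tau> head by simp_all
          then show ?thesis
            using sat_delay[OF P(1) *(1)] sat_delay[OF P(2), of p q] outer[of "t - 1" q] by auto
        next
          case (Dynamic ps A as)
          then have D: "Dynamic ps A as \<in> P" "Dynamic ps A as \<in> insert \<rho> P"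
            using \<tau>(1) by simp_all
          note len = program_Dynamic[OF P(1) D(1)]
          obtain i where i: "i \<in> {1..states A}" "p = ps ! (i - 1)"
          proof -
            have "p \<in> set ps"
              using \<tau>(2) Dynamic by simp
            then obtain k where "k < length ps" "p = ps ! k"
              by (metis in_set_conv_nth)
            then show ?thesis
              using that[of "Suc k"] len(1) by simp
          qed
          have "sat (insert \<rho> P) I t (Var (as ! k)) = sat P I t (Var (as ! k))"
            if "k \<in> {..<arity A}" for k
            using body[of "as ! k"] that len(3) Dynamic by simp
          moreover have "sat (insert \<rho> P) I (t - 1) (Var (ps ! (j - 1))) =
              sat P I (t - 1) (Var (ps ! (j - 1)))"
            if "j \<in> {1..states A}" "t \<noteq> 0" for j
          proof -
            have "ps ! (j - 1) \<in> rule_head \<tau>"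
              using that(1) len(1) Dynamic by auto
            then show ?thesis
              using outer[of "t - 1"] head that(2) by simp
          qed
          ultimately show ?thesis
            unfolding i(2) sat_dynamic[OF P(1) D(1) i(1)] sat_dynamic[OF P(2) D(2) i(1)]
            by (simp cong: conj_cong)
        qed
      qed
    qed
  qed
  note var = this
  show ?thesis
    by (rule sat_cong_vars, rule var) (use \<phi> in blast)
qed

text \<open>Programs grow by stacking rules, and formulas over old variables keep their meaning; so
  variables constructed at different stages coexist without renaming, over the same inputs.\<close>

definition extends :: "nat \<Rightarrow> rule set \<Rightarrow> rule set \<Rightarrow> bool" where
  "extends m P P' \<longleftrightarrow> P' \<in> KR_logic {flip_flop} \<and> input_vars P' = {..<m} \<and> vars P \<subseteq> vars P' \<and>
     (\<forall>I t \<phi>. vars_sform \<phi> \<subseteq> vars P \<longrightarrow> sat P' I t \<phi> = sat P I t \<phi>)"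

lemma extends_trans: "extends m P P' \<Longrightarrow> extends m P' P'' \<Longrightarrow> extends m P P''"
  unfolding extends_def by (metis subset_trans)

lemma extends_realises:
  "extends m P P' \<Longrightarrow> realises P xs \<phi> L \<Longrightarrow> vars_sform \<phi> \<subseteq> vars P \<Longrightarrow> realises P' xs \<phi> L"
  by (simp add: extends_def realises_def)

lemma extends_insert:
  assumes P: "P \<in> KR_logic {flip_flop}" "input_vars P = {..<m}"
    and \<rho>: "wf_rule \<rho>" "rule_head \<rho> \<inter> vars P = {}" "rule_body \<rho> \<subseteq> vars P"
    "\<And>ps A as. \<rho> = Dynamic ps A as \<Longrightarrow> A = flip_flop"
  shows "extends m P (insert \<rho> P)"
proof -
  have pP: "program P"
    using P(1) by (simp add: KR_logic_def)
  have pP': "program (insert \<rho> P)"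
    using \<rho>(2,3) by (intro program_insert[OF pP \<rho>(1)]) auto
  have "insert \<rho> P \<in> KR_logic {flip_flop}"
    using P(1) pP' \<rho>(4) unfolding KR_logic_def by blast
  moreover have "vars (insert \<rho> P) = vars P \<union> rule_head \<rho>"
    using \<rho>(3) by (auto simp: vars_def)
  moreover have "defined_vars (insert \<rho> P) = defined_vars P \<union> rule_head \<rho>"
    by (auto simp: defined_vars_def)
  moreover have "sat (insert \<rho> P) I t \<phi> = sat P I t \<phi>" if "vars_sform \<phi> \<subseteq> vars P" for I t \<phi>
    using that \<rho>(2) by (intro sat_insert[OF pP pP']) auto
  ultimately show ?thesis
    using P(2) \<rho>(2) unfolding extends_def input_vars_def by blast
qed

section \<open>Programs for past-definable languages\<close>

lemma fresh_var:
  assumes "P \<in> KR_logic {flip_flop}"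
  shows "\<exists>n. \<forall>k\<ge>n. k \<notin> vars P"
proof -
  have "finite (vars P)"
    using assms finite_vars by (simp add: KR_logic_def program_def)
  then obtain n where "\<forall>k\<in>vars P. k < n"
    using finite_nat_set_iff_bounded by blast
  then show ?thesis
    by (intro exI[of _ n]) force
qed

text \<open>Shannon expansion on the last variable. Every variable below \<open>m\<close> occurs
  even if \<open>f\<close> ignores it, which \<open>initial_program\<close> relies on to obtain all
  inputs.\<close>

lemma sform_of_predicate:
  "\<exists>\<phi>. vars_sform \<phi> = {..<m} \<and> (\<forall>P I t. sat P I t \<phi> \<longleftrightarrow> f (map (\<lambda>k. sat P I t (Var k)) [0..<m]))"
proof (induction m arbitrary: f)
  case 0
  show ?case
    by (rule exI[of _ "if f [] then Top else Bot"]) simp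
next
  case (Suc m)
  obtain \<phi> where \<phi>: "vars_sform \<phi> = {..<m}"
    "\<forall>P I t. sat P I t \<phi> \<longleftrightarrow> f (map (\<lambda>k. sat P I t (Var k)) [0..<m] @ [True])"
    using Suc[of "\<lambda>\<sigma>. f (\<sigma> @ [True])"] by (elim exE conjE)
  obtain \<psi> where \<psi>: "vars_sform \<psi> = {..<m}"
    "\<forall>P I t. sat P I t \<psi> \<longleftrightarrow> f (map (\<lambda>k. sat P I t (Var k)) [0..<m] @ [False])"
    using Suc[of "\<lambda>\<sigma>. f (\<sigma> @ [False])"] by (elim exE conjE)
  let ?\<chi> = "Or (And (Var m) \<phi>) (And (Neg (Var m)) \<psi>)"
  have "vars_sform ?\<chi> = {..<Suc m}"
    by (simp add: \<phi>(1) \<psi>(1) lessThan_Suc)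
  moreover have "sat P I t ?\<chi> \<longleftrightarrow> f (map (\<lambda>k. sat P I t (Var k)) [0..<Suc m])" for P I t
    by (cases "sat P I t (Var m)") (simp_all add: \<phi>(2) \<psi>(2))
  ultimately show ?case
    by (intro exI[of _ ?\<chi>] conjI allI)
qed

lemma extend_static:
  assumes P: "P \<in> KR_logic {flip_flop}" "input_vars P = {..<m}"
    and "vars_sform \<alpha> \<subseteq> vars P" "realises P xs \<alpha> L"
  shows "\<exists>P' a. extends m P P' \<and> a \<in> vars P' \<and> realises P' xs (Var a) L"
proof -
  obtain n where n: "\<And>k. n \<le> k \<Longrightarrow> k \<notin> vars P"
    using fresh_var[OF P(1)] by blast
  let ?P = "insert (Static n \<alpha>) P"
  have ext: "extends m P ?P"
    using assms n by (intro extends_insert[OF P]) auto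
  then have "realises ?P xs \<alpha> L" "program ?P"
    using assms extends_realises by (auto simp: extends_def KR_logic_def)
  then have "realises ?P xs (Var n) L"
    by (intro realises_static[of ?P n \<alpha>]) auto
  moreover have "n \<in> vars ?P"
    by (simp add: vars_def)
  ultimately show ?thesis
    using ext by blast
qed

lemma extend_delay:
  assumes P: "P \<in> KR_logic {flip_flop}" "input_vars P = {..<m}"
    and "q \<in> vars P" "realises P xs (Var q) L"
  shows "\<exists>P' a. extends m P P' \<and> a \<in> vars P' \<and> realises P' xs (Var a) (delay L)"
proof -
  obtain n where n: "\<And>k. n \<le> k \<Longrightarrow> k \<notin> vars P"
    using fresh_var[OF P(1)] by blast
  let ?P = "insert (Delay n q) P"
  have ext: "extends m P ?P"
    using assms n by (intro extends_insert[OF P]) auto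
  then have "realises ?P xs (Var q) L" "program ?P"
    using assms extends_realises by (auto simp: extends_def KR_logic_def)
  then have "realises ?P xs (Var n) (delay L)"
    by (intro realises_delay[of ?P n q]) auto
  moreover have "n \<in> vars ?P"
    by (simp add: vars_def)
  ultimately show ?thesis
    using ext by blast
qed

lemma wf_automaton_flip_flop: "wf_automaton flip_flop"
proof -
  have "flip_flop_delta q [a, b] \<in> {1..2}" if "q \<in> {1..2}" for q a b
    using that by (cases a; cases b) auto
  then show ?thesis
    unfolding wf_automaton_def flip_flop_def by (auto simp: bools_2)
qed

lemma extend_latch:
  assumes P: "P \<in> KR_logic {flip_flop}" "input_vars P = {..<m}"
    and "s \<in> vars P" "realises P xs (Var s) S" "r \<in> vars P" "realises P xs (Var r) R"
  shows "\<exists>P' a. extends m P P' \<and> a \<in> vars P' \<and> realises P' xs (Var a) (latch S R)"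
proof -
  obtain n where n: "\<And>k. n \<le> k \<Longrightarrow> k \<notin> vars P"
    using fresh_var[OF P(1)] by blast
  let ?\<rho> = "Dynamic [n, Suc n] flip_flop [s, r]"
  let ?P = "insert ?\<rho> P"
  have "wf_rule ?\<rho>"
    using wf_automaton_flip_flop by (simp add: flip_flop_def)
  then have ext: "extends m P ?P"
    using assms n[of n] n[of "Suc n"] by (intro extends_insert[OF P]) auto
  then have "realises ?P xs (Var s) S" "realises ?P xs (Var r) R" "program ?P"
    using assms extends_realises by (auto simp: extends_def KR_logic_def)
  then have "realises ?P xs (Var (Suc n)) (latch S R)"
    by (intro realises_latch(1)[of ?P n "Suc n" s r]) auto
  moreover have "Suc n \<in> vars ?P"
    by (simp add: vars_def)
  ultimately show ?thesis
    using ext by blast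
qed

text \<open>Starting from an arbitrary \<open>P\<close> allows the second operand of a union or a
  latch to be built on top of the program for the first.\<close>

theorem past_definable_extend:
  assumes "past_definable L" "P \<in> KR_logic {flip_flop}" "input_vars P = {..<m}"
  shows "\<exists>P' a. extends m P P' \<and> a \<in> vars P' \<and> realises P' [0..<m] (Var a) L"
  using assms
proof (induction arbitrary: P rule: past_definable.induct)
  case (ends_in X)
  obtain \<phi> where \<phi>: "vars_sform \<phi> = {..<m}"
    "\<And>P I t. sat P I t \<phi> \<longleftrightarrow> map (\<lambda>k. sat P I t (Var k)) [0..<m] \<in> X"
    using sform_of_predicate[of m "\<lambda>\<sigma>. \<sigma> \<in> X"] by blast
  \<comment> \<open>Prepares a variable for \<open>delay UNIV\<close>, true from time
    \<open>1\<close> on. At time \<open>0\<close> all inputs are false, so \<open>\<phi>\<close> may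
    hold there, whereas \<open>ends_in X\<close> excludes the empty word.\<close>
  have "\<exists>P1 a1. extends m P P1 \<and> a1 \<in> vars P1 \<and> realises P1 [0..<m] (Var a1) UNIV"
    by (rule extend_static[OF ends_in _ realises_Top]) simp
  then obtain P1 a1 where 1: "extends m P P1" "a1 \<in> vars P1" "realises P1 [0..<m] (Var a1) UNIV"
    by blast
  then have P1: "P1 \<in> KR_logic {flip_flop}" "input_vars P1 = {..<m}"
    by (simp_all add: extends_def)
  obtain P2 a2 where 2: "extends m P1 P2" "a2 \<in> vars P2" "realises P2 [0..<m] (Var a2) (delay UNIV)"
    using extend_delay[OF P1 1(2,3)] by blast
  then have P2: "P2 \<in> KR_logic {flip_flop}" "input_vars P2 = {..<m}"
    by (simp_all add: extends_def)
  have pP2: "program P2"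
    using P2(1) by (simp add: KR_logic_def)
  have "realises P2 [0..<m] (And (Var a2) \<phi>) (ends_in X)"
  proof (rule realisesI)
    fix w t assume w: "w \<in> lists (bools (length [0..<m]))" "t \<le> length w"
    let ?I = "map (letter_interp [0..<m]) w"
    show "sat P2 ?I t (And (Var a2) \<phi>) \<longleftrightarrow> take t w \<in> ends_in X"
    proof (cases "t = 0")
      case True
      then show ?thesis
        using realisesD[OF 2(3) w] by simp
    next
      case False
      have "w ! (t - 1) \<in> set w"
        using False w(2) by simp
      then have len: "length (w ! (t - 1)) = m"
        using w(1) by (auto simp: bools_def)
      have "sat P2 ?I t (Var k) \<longleftrightarrow> w ! (t - 1) ! k" if "k < m" for k
      proof -
        have "k \<notin> defined_vars P2"
          using P2(2) that by (auto simp: input_vars_def)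
        then show ?thesis
          using realisesD[OF realises_input[OF pP2, of k "[0..<m]" k] w] that False w(2)
          by (simp add: take_pos)
      qed
      then have "map (\<lambda>k. sat P2 ?I t (Var k)) [0..<m] = w ! (t - 1)"
        using len by (intro nth_equalityI) simp_all
      then show ?thesis
        using realisesD[OF 2(3) w] False w(2) by (simp add: \<phi>(2) take_pos)
    qed
  qed
  moreover have "vars_sform (And (Var a2) \<phi>) \<subseteq> vars P2"
    using 2(2) \<phi>(1) P2(2) by (auto simp: input_vars_def)
  ultimately obtain P3 a3 where "extends m P2 P3"
    "a3 \<in> vars P3" "realises P3 [0..<m] (Var a3) (ends_in X)"
    using extend_static[OF P2] by blast
  then show ?case
    using 1(1) 2(1) extends_trans by blast
next
  case (Compl L)
  then obtain P1 a1 where 1: "extends m P P1" "a1 \<in> vars P1" "realises P1 [0..<m] (Var a1) L"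
    by blast
  then have P1: "P1 \<in> KR_logic {flip_flop}" "input_vars P1 = {..<m}"
    by (simp_all add: extends_def)
  show ?case
    using extend_static[OF P1 _ realises_Neg[OF 1(3)]] 1(1,2) extends_trans by fastforce
next
  case (Un L L')
  then obtain P1 a1 where 1: "extends m P P1" "a1 \<in> vars P1" "realises P1 [0..<m] (Var a1) L"
    by blast
  then have P1: "P1 \<in> KR_logic {flip_flop}" "input_vars P1 = {..<m}"
    by (simp_all add: extends_def)
  obtain P2 a2 where 2: "extends m P1 P2" "a2 \<in> vars P2" "realises P2 [0..<m] (Var a2) L'"
    using Un.IH(2)[OF P1] by blast
  then have P2: "P2 \<in> KR_logic {flip_flop}" "input_vars P2 = {..<m}" "a1 \<in> vars P2"
    using 1(2) by (auto simp: extends_def)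
  have "realises P2 [0..<m] (Var a1) L"
    using extends_realises[OF 2(1) 1(3)] 1(2) by simp
  then have "\<exists>P' a. extends m P2 P' \<and> a \<in> vars P' \<and> realises P' [0..<m] (Var a) (L \<union> L')"
    using 2 P2(3) by (intro extend_static[OF P2(1,2) _ realises_Or]) auto
  then show ?case
    using 1(1) 2(1) extends_trans by blast
next
  case (delay L)
  then obtain P1 a1 where 1: "extends m P P1" "a1 \<in> vars P1" "realises P1 [0..<m] (Var a1) L"
    by blast
  then have P1: "P1 \<in> KR_logic {flip_flop}" "input_vars P1 = {..<m}"
    by (simp_all add: extends_def)
  show ?case
    using extend_delay[OF P1 1(2,3)] 1(1) extends_trans by blast
next
  case (latch S R)
  then obtain P1 a1 where 1: "extends m P P1" "a1 \<in> vars P1" "realises P1 [0..<m] (Var a1) S"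
    by blast
  then have P1: "P1 \<in> KR_logic {flip_flop}" "input_vars P1 = {..<m}"
    by (simp_all add: extends_def)
  obtain P2 a2 where 2: "extends m P1 P2" "a2 \<in> vars P2" "realises P2 [0..<m] (Var a2) R"
    using latch.IH(2)[OF P1] by blast
  then have P2: "P2 \<in> KR_logic {flip_flop}" "input_vars P2 = {..<m}" "a1 \<in> vars P2"
    using 1(2) by (auto simp: extends_def)
  have "realises P2 [0..<m] (Var a1) S"
    using extends_realises[OF 2(1) 1(3)] 1(2) by simp
  then show ?case
    using extend_latch[OF P2(1-3) _ 2(2,3)] 1(1) 2(1) extends_trans by blast
qed

text \<open>The single rule serves to make every \<open>k < m\<close> an input variable.\<close>

lemma initial_program: "\<exists>P. P \<in> KR_logic {flip_flop} \<and> input_vars P = {..<m}"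
proof -
  obtain \<phi> where \<phi>: "vars_sform \<phi> = {..<m}"
    using sform_of_predicate[of m "\<lambda>_. True"] by blast
  let ?P = "insert (Static m \<phi>) {}"
  have "program {}"
    by (auto simp: program_def nonrecursive_def definitorial_def dep_graph_def acyclic_def)
  then have "program ?P"
    using \<phi> by (intro program_insert) (auto simp: vars_def)
  then have "?P \<in> KR_logic {flip_flop}"
    by (simp add: KR_logic_def)
  moreover have "input_vars ?P = {..<m}"
    using \<phi> by (auto simp: input_vars_def vars_def defined_vars_def)
  ultimately show ?thesis
    by blast
qed

lemma recognised_language_realises:
  assumes "realises P xs (Var a) L"
  shows "recognised_language P xs a = {w \<in> lists (bools (length xs)). w \<noteq> [] \<and> w \<in> L}"
  using realisesD[OF assms _ order_refl] by (auto simp: recognised_language_def)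

lemma finite_bools: "finite (bools m)"
  using finite_lists_length_eq[of "UNIV :: bool set" m] by (simp add: bools_def)

text \<open>Interpretations are non-empty, so no program recognises the empty word; star-free
  languages are accordingly taken without it.\<close>

theorem theorem6:
  fixes m :: nat
  shows "expressivity (KR_logic {flip_flop}) m = {L. star_free (bools m) L \<and> [] \<notin> L}"
proof (intro set_eqI iffI)
  fix L assume "L \<in> expressivity (KR_logic {flip_flop}) m"
  then obtain P xs a where *: "L = recognised_language P xs a" "P \<in> KR_logic {flip_flop}"
    "length xs = m" "distinct xs"
    by (auto simp: expressivity_def)
  obtain K where K: "past_definable K" "realises P xs (Var a) K"
    using program_past_definable[OF *(2,4)] by blast
  \<comment> \<open>Expresses the restriction to non-empty strings by a past-definable
    language.\<close>
  have "w \<noteq> [] \<longleftrightarrow> w \<in> ends_in UNIV" for w :: "bool list list"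
    by (cases w rule: rev_cases) auto
  then have "L = (K \<inter> ends_in UNIV) \<inter> lists (bools m)"
    unfolding *(1) recognised_language_realises[OF K(2)] *(3) by blast
  then show "L \<in> {L. star_free (bools m) L \<and> [] \<notin> L}"
    using past_definable_star_free[OF finite_bools past_definable_Int[OF K(1) past_definable.ends_in]]
    by simp
next
  fix L assume L: "L \<in> {L. star_free (bools m) L \<and> [] \<notin> L}"
  then have sf: "star_free (bools m) L" "[] \<notin> L"
    by simp_all
  obtain P0 where P0: "P0 \<in> KR_logic {flip_flop}" "input_vars P0 = {..<m}"
    using initial_program by blast
  obtain P a where P: "extends m P0 P" "a \<in> vars P" "realises P [0..<m] (Var a) L"
    using past_definable_extend[OF star_free_past_definable[OF finite_bools sf(1)] P0] by blast
  have "L = recognised_language P [0..<m] a"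
    unfolding recognised_language_realises[OF P(3)]
    using star_free_subset[OF sf(1)] sf(2) by auto
  moreover have "P \<in> KR_logic {flip_flop}" "set [0..<m] = input_vars P"
    using P(1) by (auto simp: extends_def)
  ultimately show "L \<in> expressivity (KR_logic {flip_flop}) m"
    unfolding expressivity_def using P(2)
    by (intro CollectI exI[of _ P] exI[of _ "[0..<m]"] exI[of _ a]) simp
qed

end
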